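(* Let $n\ge 2$, let $\Omega\in L^s(\mathbf{S}^{n-1})$ with $1<s\leq\infty$, where $\Omega$ is homogeneous of degree zero on $\mathbb R^n$, and let $s'$ be the conjugate exponent of $s$. Let $0<\alpha<n$, $1\leq p<q<\infty$ and $1/q=1/p-\alpha/n$. (i) If $s'=p<n/\alpha$, then there is a constant $C>0$ independent of $f$ such that $\|T_{\Omega,\alpha}(f)\|_{L^{q,\infty}}\le C\|f\|_{L^p}$ for all $f\in L^p(\mathbb R^n)$. (ii) If $s'<p<n/\alpha$, then there is a constant $C>0$ independent of $f$ such that $\|T_{\Omega,\alpha}(f)\|_{L^q}\le C\|f\|_{L^p}$ for all $f\in L^p(\mathbb R^n)$.
   Context: $\mathbf{S}^{n-1}$ is the unit sphere of $\mathbb R^n$ ($n\ge2$) with normalized Lebesgue measure $d\sigma$; $m$ is Lebesgue measure on $\mathbb R^n$. "$\Omega$ homogeneous of degree zero" means $\Omega(tx)=\Omega(x)$ for $t>0$, $x\ne0$. The homogeneous fractional integral operator is $T_{\Omega,\alpha}f(x):=\int_{\mathbb R^n}\frac{\Omega(x-y)}{|x-y|^{n-\alpha}}f(y)\,dy$. The weak Lebesgue quasi-norm is $\|f\|_{L^{q,\infty}}:=\sup_{\lambda>0}\lambda\, m(\{x\in\mathbb R^n:|f(x)|>\lambda\})^{1/q}$. The conjugate exponent satisfies $1/s+1/s'=1$ ($s'=1$ if $s=\infty$). *)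

theory Defs
  imports "HOL-Analysis.Analysis" "HOL-Probability.Essential_Supremum"
begin

text \<open>
  Normalized Lebesgue (surface) measure on the unit sphere, obtained as the cone measure:
  a Borel set \<open>A\<close> of the sphere gets mass \<open>m {r x | 0 < r < 1, x \<in> A} / m (ball 0 1)\<close>.
  Here \<open>sgn x = x / |x|\<close>; the centre is removed because it has no direction.  The completion
  makes the measurable sets the Lebesgue measurable ones.
\<close>

definition sphere_measure :: "'a::euclidean_space measure" where
  "sphere_measure =
     completion
       (scale_measure (1 / emeasure lborel (ball (0::'a) 1))
         (distr (restrict_space lborel (ball 0 1 - {0})) (restrict_space borel (sphere 0 1)) sgn))"

lemma space_sphere_measure: "space (sphere_measure :: 'a::euclidean_space measure) = sphere 0 1"
  by (simp add: sphere_measure_def space_scale_measure space_restrict_space)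

lemma sgn_measurable_sphere:
  "sgn \<in> restrict_space lborel (ball 0 1 - {0}) \<rightarrow>\<^sub>M restrict_space borel (sphere (0::'a::euclidean_space) 1)"
proof (rule measurable_restrict_space2)
  show "sgn \<in> space (restrict_space lborel (ball 0 1 - {0})) \<rightarrow> sphere (0::'a) 1"
    by (auto simp: space_restrict_space norm_sgn)
  have "(sgn :: 'a \<Rightarrow> 'a) \<in> borel_measurable borel"
    unfolding sgn_div_norm by measurable
  then show "(sgn :: 'a \<Rightarrow> 'a) \<in> borel_measurable (restrict_space lborel (ball 0 1 - {0}))"
    by (intro measurable_restrict_space1) simp
qed

lemma emeasure_sphere_measure:
  fixes A :: "'a::euclidean_space set"
  assumes "A \<in> sets borel" "A \<subseteq> sphere 0 1"
  shows "emeasure sphere_measure A =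
           emeasure lborel {x \<in> ball 0 1 - {0}. sgn x \<in> A} / emeasure lborel (ball (0::'a) 1)"
proof -
  let ?R = "restrict_space lborel (ball 0 1 - {0}) :: 'a measure"
  have A: "A \<in> sets (restrict_space borel (sphere 0 1))"
    using assms by (auto simp: sets_restrict_space)
  have "emeasure (distr ?R (restrict_space borel (sphere 0 1)) sgn) A
          = emeasure ?R (sgn -` A \<inter> space ?R)"
    by (rule emeasure_distr[OF sgn_measurable_sphere A])
  also have "\<dots> = emeasure lborel (sgn -` A \<inter> space ?R)"
    by (rule emeasure_restrict_space) (auto simp: space_restrict_space)
  also have "sgn -` A \<inter> space ?R = {x \<in> ball 0 1 - {0}. sgn x \<in> A}"
    by (auto simp: space_restrict_space)
  finally show ?thesis
    using A by (simp add: sphere_measure_def ennreal_times_divide[symmetric] divide_ennreal_def mult.commute)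
qed

lemma emeasure_sphere_measure_sphere:
  "emeasure sphere_measure (sphere (0::'a::euclidean_space) 1) = 1"
proof -
  have "{x \<in> ball 0 1 - {0}. sgn x \<in> sphere (0::'a) 1} = ball 0 1 - {0}"
    by (auto simp: norm_sgn)
  moreover have "emeasure lborel (ball (0::'a) 1 - {0}) = emeasure lborel (ball (0::'a) 1)"
    by (rule emeasure_Diff_null_set) auto
  moreover have "emeasure lborel (ball (0::'a) 1) \<noteq> 0" "emeasure lborel (ball (0::'a) 1) \<noteq> top"
    using content_ball_pos[of 1 "0::'a"] emeasure_lborel_ball_finite[of "0::'a" 1]
    by (auto simp: measure_def)
  ultimately show ?thesis
    by (simp add: emeasure_sphere_measure less_top)
qed

text \<open>
  Real powers of extended nonnegative reals; used only for positive exponents, so that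
  \<open>top\<close> goes to \<open>top\<close> and \<open>0\<close> to \<open>0\<close>.
\<close>

definition enn_powr :: "ennreal \<Rightarrow> real \<Rightarrow> ennreal" where
  "enn_powr a r = (if a = top then top else ennreal (enn2real a powr r))"

definition Lp_norm :: "'a measure \<Rightarrow> ennreal \<Rightarrow> ('a \<Rightarrow> 'b::real_normed_vector) \<Rightarrow> ennreal" where
  "Lp_norm M p f =
     (if p = top then esssup M (\<lambda>x. ennreal (norm (f x)))
      else enn_powr (\<integral>\<^sup>+x. ennreal (norm (f x) powr enn2real p) \<partial>M) (1 / enn2real p))"

definition Lp_space :: "'a measure \<Rightarrow> ennreal \<Rightarrow> ('a \<Rightarrow> 'b::real_normed_vector) set" where
  "Lp_space M p = {f \<in> borel_measurable M. Lp_norm M p f < top}"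

definition weak_Lp_norm :: "'a measure \<Rightarrow> real \<Rightarrow> ('a \<Rightarrow> 'b::real_normed_vector) \<Rightarrow> ennreal" where
  "weak_Lp_norm M q f =
     (SUP t\<in>{0<..}. ennreal t * enn_powr (emeasure M {x \<in> space M. norm (f x) > t}) (1 / q))"

definition homogeneous_degree_zero :: "('a::real_vector \<Rightarrow> 'b) \<Rightarrow> bool" where
  "homogeneous_degree_zero \<Omega> \<longleftrightarrow> (\<forall>t>0. \<forall>x. x \<noteq> 0 \<longrightarrow> \<Omega> (t *\<^sub>R x) = \<Omega> x)"

definition frac_integrand ::
    "(real^'n \<Rightarrow> complex) \<Rightarrow> real \<Rightarrow> (real^'n \<Rightarrow> complex) \<Rightarrow> real^'n \<Rightarrow> real^'n \<Rightarrow> complex" where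
  "frac_integrand \<Omega> \<alpha> f x y =
     \<Omega> (x - y) / complex_of_real (norm (x - y) powr (real CARD('n) - \<alpha>)) * f y"

text \<open>
  The Bochner integral is \<open>0\<close> by convention at points \<open>x\<close> where the integrand is not integrable,
  so statements about this operator should also assert integrability for almost every \<open>x\<close>.
\<close>

definition frac_integral ::
    "(real^'n \<Rightarrow> complex) \<Rightarrow> real \<Rightarrow> (real^'n \<Rightarrow> complex) \<Rightarrow> real^'n \<Rightarrow> complex" where
  "frac_integral \<Omega> \<alpha> f x = (\<integral>y. frac_integrand \<Omega> \<alpha> f x y \<partial>lebesgue)"

text \<open>The defining integral converges absolutely almost everywhere, to a measurable function.\<close>

definition frac_integral_well_defined ::
    "(real^'n \<Rightarrow> complex) \<Rightarrow> real \<Rightarrow> (real^'n \<Rightarrow> complex) \<Rightarrow> bool" where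
  "frac_integral_well_defined \<Omega> \<alpha> f \<longleftrightarrow>
     (AE x in lebesgue. integrable lebesgue (frac_integrand \<Omega> \<alpha> f x)) \<and>
     frac_integral \<Omega> \<alpha> f \<in> borel_measurable lebesgue"

end

theory Submission
  imports Defs
begin

text \<open>
  Split the kernel \<open>|\<Omega> z| |z| powr (\<alpha> - n)\<close> at radius \<open>r\<close>.  The near part has integral
  \<open>O(r powr \<alpha>)\<close>.  Since \<open>p \<ge> s'\<close> means \<open>p' \<le> s\<close>, the far part lies in \<open>L^p'\<close> and convolves \<open>f\<close>
  with \<open>\<parallel>f\<parallel>\<^sub>p = 1\<close> into a function bounded by \<open>O(r powr (- n / q))\<close>.  At level \<open>l\<close>, choose \<open>r\<close> so that
  this bound is \<open>l\<close>, and cut \<open>f\<close> at the height \<open>h = D l powr (q / p)\<close> below which the near part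
  contributes at most \<open>l\<close> too.  Markov's inequality for the rest gives
  \<open>m {|T f| > 3 l} \<le> (1 / h) (integral of |f| over {|f| > h})\<close>.  The weak bound is immediate from this; for \<open>p > 1\<close> the
  strong bound follows by integrating in \<open>l\<close> and exchanging the integrals, so that neither
  interpolation nor a maximal function is needed.
\<close>

text \<open>For finite \<open>s\<close> no pointwise bound on the kernel is available, only the mass
  of a power of \<open>|\<Omega>|\<close> in the unit ball. The cone form of the sphere measure
  delivers precisely that, and dilation invariance carries it to dyadic annuli, where geometric
  series do the work of polar coordinates. The Markov estimate keeps the integral over
  \<open>{|f| > h}\<close> with \<open>h\<close> depending on \<open>l\<close>. This retained cut is
  what yields the strong bound; once it is replaced by the full \<open>L^p\<close> norm, only the
  weak bound is left. Another obstacle is that convergence of \<open>T f\<close> is not known in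
  advance. The estimates are therefore made for the convolution of absolute values in the extended
  reals; its weak bound shows finiteness almost everywhere, which is absolute convergence. Tonelli's
  theorem for these convolutions is applied to Borel functions on the whole space, whereas
  \<open>\<Omega>\<close> and \<open>f\<close> are measurable only for completed measures, so both
  are replaced by Borel representatives.\<close>

section \<open>Scaling of Lebesgue integrals and dyadic bounds for homogeneous weights\<close>

lemma nn_integral_lborel_affine:
  fixes f :: "'a::euclidean_space \<Rightarrow> ennreal"
  assumes [measurable]: "f \<in> borel_measurable borel" and "c \<noteq> 0"
  shows "(\<integral>\<^sup>+x. f x \<partial>lborel) = ennreal (\<bar>c\<bar> ^ DIM('a)) * (\<integral>\<^sup>+x. f (t + c *\<^sub>R x) \<partial>lborel)"
  by (subst lborel_affine[OF \<open>c \<noteq> 0\<close>, of t])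
     (simp add: nn_integral_density nn_integral_distr nn_integral_cmult ennreal_power)

lemma nn_integral_lborel_reflect:
  fixes f :: "'a::euclidean_space \<Rightarrow> ennreal"
  assumes "f \<in> borel_measurable borel"
  shows "(\<integral>\<^sup>+y. f (x - y) \<partial>lborel) = (\<integral>\<^sup>+y. f y \<partial>lborel)"
  using nn_integral_lborel_affine[OF assms, of "-1" x] by simp

lemma nn_integral_lborel_shift:
  fixes f :: "'a::euclidean_space \<Rightarrow> ennreal"
  assumes "f \<in> borel_measurable borel"
  shows "(\<integral>\<^sup>+x. f (x - y) \<partial>lborel) = (\<integral>\<^sup>+x. f x \<partial>lborel)"
  using nn_integral_lborel_affine[OF assms, of 1 "-y"] by simp

lemma nn_integral_homogeneous_ball:
  fixes W :: "'a::euclidean_space \<Rightarrow> ennreal"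
  assumes [measurable]: "W \<in> borel_measurable borel"
    and hom: "\<forall>t>0. \<forall>x. W (t *\<^sub>R x) = W x" and "r > 0"
  shows "(\<integral>\<^sup>+x. W x * indicator (ball 0 r) x \<partial>lborel)
       = ennreal (r ^ DIM('a)) * (\<integral>\<^sup>+x. W x * indicator (ball 0 1) x \<partial>lborel)"
proof -
  have "indicator (ball 0 r) (r *\<^sub>R x) = (indicator (ball 0 1) x :: ennreal)" for x :: 'a
    using \<open>r > 0\<close> by (auto simp: indicator_def)
  moreover have "(\<lambda>x. W x * indicator (ball 0 r) x) \<in> borel_measurable borel"
    by (intro borel_measurable_times_ennreal borel_measurable_indicator) simp_all
  ultimately show ?thesis
    using \<open>r > 0\<close> by (subst nn_integral_lborel_affine[of _ r 0]) (simp_all add: hom)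
qed

text \<open>The radial weight is at most \<open>2 powr \<bar>b\<bar> * r powr b\<close> on the
  annulus for either sign of \<open>b\<close>, so it comes out of the integral. The annulus is then
  enlarged to the ball of radius \<open>2 * r\<close>, whose mass is known by scaling.\<close>

lemma nn_integral_homogeneous_annulus:
  fixes W :: "'a::euclidean_space \<Rightarrow> ennreal" and b :: real
  assumes [measurable]: "W \<in> borel_measurable borel"
    and hom: "\<forall>t>0. \<forall>x. W (t *\<^sub>R x) = W x" and "r > 0"
  shows "(\<integral>\<^sup>+x. W x * ennreal (norm x powr b) * indicator {x. r \<le> norm x \<and> norm x < 2 * r} x \<partial>lborel)
       \<le> ennreal (2 powr (\<bar>b\<bar> + DIM('a)) * r powr (b + DIM('a)))
            * (\<integral>\<^sup>+x. W x * indicator (ball 0 1) x \<partial>lborel)"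
proof -
  have le: "norm x powr b \<le> 2 powr \<bar>b\<bar> * r powr b" if "r \<le> norm x" "norm x < 2 * r" for x :: 'a
  proof (cases "b \<ge> 0")
    case True
    then have "norm x powr b \<le> (2 * r) powr b"
      using that \<open>r > 0\<close> by (intro powr_mono2) auto
    then show ?thesis using True \<open>r > 0\<close> by (simp add: powr_mult)
  next
    case False
    then have "norm x powr b \<le> r powr b"
      using that \<open>r > 0\<close> by (intro powr_mono2') auto
    also have "\<dots> \<le> 2 powr \<bar>b\<bar> * r powr b"
      using ge_one_powr_ge_zero[of 2 "\<bar>b\<bar>"] mult_right_mono[of 1 "2 powr \<bar>b\<bar>" "r powr b"] by simp
    finally show ?thesis .
  qed
  have "(\<integral>\<^sup>+x. W x * ennreal (norm x powr b) * indicator {x. r \<le> norm x \<and> norm x < 2 * r} x \<partial>lborel)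
      \<le> (\<integral>\<^sup>+x. ennreal (2 powr \<bar>b\<bar> * r powr b) * (W x * indicator (ball 0 (2 * r)) x) \<partial>lborel)"
  proof (intro nn_integral_mono)
    fix x :: 'a
    show "W x * ennreal (norm x powr b) * indicator {x. r \<le> norm x \<and> norm x < 2 * r} x
        \<le> ennreal (2 powr \<bar>b\<bar> * r powr b) * (W x * indicator (ball 0 (2 * r)) x)"
    proof (cases "r \<le> norm x \<and> norm x < 2 * r")
      case True
      then have "ennreal (norm x powr b) * W x \<le> ennreal (2 powr \<bar>b\<bar> * r powr b) * W x"
        by (intro mult_right_mono ennreal_leI le) auto
      then show ?thesis using True by (simp add: mult.commute)
    qed simp
  qed
  also have "\<dots> = ennreal (2 powr \<bar>b\<bar> * r powr b) * (ennreal ((2 * r) ^ DIM('a)) *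
                     (\<integral>\<^sup>+x. W x * indicator (ball 0 1) x \<partial>lborel))"
  proof -
    have "(\<lambda>x. W x * indicator (ball 0 (2 * r)) x) \<in> borel_measurable lborel"
      by (intro borel_measurable_times_ennreal borel_measurable_indicator) simp_all
    then show ?thesis
      using nn_integral_homogeneous_ball[OF assms(1) hom, of "2 * r"] \<open>r > 0\<close>
      by (simp only: nn_integral_cmult)
  qed
  also have "\<dots> = ennreal (2 powr \<bar>b\<bar> * r powr b * (2 * r) ^ DIM('a)) * (\<integral>\<^sup>+x. W x * indicator (ball 0 1) x \<partial>lborel)"
    using \<open>r > 0\<close> by (simp add: ennreal_mult'' mult.assoc)
  also have "2 powr \<bar>b\<bar> * r powr b * (2 * r) ^ DIM('a) = 2 powr (\<bar>b\<bar> + DIM('a)) * r powr (b + DIM('a))"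
    using \<open>r > 0\<close> by (simp add: powr_add powr_realpow power_mult_distrib)
  finally show ?thesis .
qed

text \<open>Common source of the near and the far estimate: passing to the next annulus multiplies
  the bound by \<open>a powr (b + DIM('a))\<close>, so a geometric series converges for
  \<open>a = 1/2\<close> when the exponent is positive and for \<open>a = 2\<close> when it is
  negative.\<close>

lemma nn_integral_homogeneous_annuli:
  fixes W :: "'a::euclidean_space \<Rightarrow> ennreal" and b :: real
  assumes [measurable]: "W \<in> borel_measurable borel"
    and hom: "\<forall>t>0. \<forall>x. W (t *\<^sub>R x) = W x"
    and J: "(\<integral>\<^sup>+x. W x * indicator (ball 0 1) x \<partial>lborel) < top"
    and a: "a > 0" "a powr (b + DIM('a)) < 1"
  shows "\<exists>C>0. \<forall>r>0. \<forall>S. S \<in> sets borel \<and> 0 \<notin> S \<and>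
        (\<forall>x\<in>S. \<exists>k::nat. r * a ^ k \<le> norm x \<and> norm x < 2 * (r * a ^ k)) \<longrightarrow>
       (\<integral>\<^sup>+x. W x * ennreal (norm x powr b) * indicator S x \<partial>lborel)
        \<le> ennreal (C * r powr (b + DIM('a)))"
proof -
  define g where "g = b + DIM('a)"
  obtain j where j: "j \<ge> 0" "(\<integral>\<^sup>+x. W x * indicator (ball 0 1) x \<partial>lborel) = ennreal j"
    using J by (metis less_top_ennreal)
  define c where "c = 2 powr (\<bar>b\<bar> + DIM('a)) * j"
  have "c \<ge> 0" using j by (simp add: c_def)
  \<comment> \<open>The added 1 keeps \<open>C\<close> positive when \<open>W\<close> has no mass in
    the unit ball.\<close>
  define C where "C = c * (1 / (1 - a powr g)) + 1"
  show ?thesis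
  proof (intro exI[of _ C] conjI allI impI; (elim conjE)?)
    show "C > 0" using \<open>c \<ge> 0\<close> a by (simp add: C_def g_def add_nonneg_pos)
    fix r :: real and S :: "'a set" assume r: "r > 0" and [measurable]: "S \<in> sets borel" and "0 \<notin> S"
      and S: "\<forall>x\<in>S. \<exists>k::nat. r * a ^ k \<le> norm x \<and> norm x < 2 * (r * a ^ k)"
    define A where "A k = {x :: 'a. r * a ^ k \<le> norm x \<and> norm x < 2 * (r * a ^ k)}" for k :: nat
    have [measurable]: "A k \<in> sets borel" for k by (simp add: A_def)
    define h where "h x = W x * ennreal (norm x powr b)" for x
    have [measurable]: "h \<in> borel_measurable borel" by (simp add: h_def[abs_def])
    have "(\<integral>\<^sup>+x. h x * indicator S x \<partial>lborel) \<le> (\<integral>\<^sup>+x. (\<Sum>k. h x * indicator (A k) x) \<partial>lborel)"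
    proof (intro nn_integral_mono)
      fix x
      show "h x * indicator S x \<le> (\<Sum>k. h x * indicator (A k) x)"
      proof (cases "x \<in> S")
        case True
        then obtain k where "x \<in> A k" using S by (auto simp: A_def)
        moreover have "sum (\<lambda>k. h x * indicator (A k) x) {k} \<le> (\<Sum>k. h x * indicator (A k) x)"
          by (rule sum_le_suminf) auto
        ultimately show ?thesis using True by simp
      qed simp
    qed
    also have "\<dots> = (\<Sum>k. \<integral>\<^sup>+x. h x * indicator (A k) x \<partial>lborel)"
      by (rule nn_integral_suminf) simp
    also have "\<dots> \<le> (\<Sum>k. ennreal (c * r powr g * (a powr g) ^ k))"
    proof (intro suminf_le summableI)
      fix k
      have "(\<integral>\<^sup>+x. h x * indicator (A k) x \<partial>lborel)
          \<le> ennreal (2 powr (\<bar>b\<bar> + DIM('a)) * (r * a ^ k) powr g) * ennreal j"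
      proof -
        have "r * a ^ k > 0" using r a(1) by simp
        from nn_integral_homogeneous_annulus[OF assms(1) hom this, where b=b] show ?thesis
          unfolding h_def A_def g_def j(2) .
      qed
      also have "\<dots> = ennreal (c * r powr g * (a powr g) ^ k)"
      proof -
        have "(a ^ k) powr g = (a powr g) ^ k"
          using a(1) by (induction k) (simp_all add: powr_mult)
        then have "2 powr (\<bar>b\<bar> + DIM('a)) * (r * a ^ k) powr g * j = c * r powr g * (a powr g) ^ k"
          using r a(1) by (simp add: c_def powr_mult)
        then show ?thesis
          using j(1) by (metis ennreal_mult'')
      qed
      finally show "(\<integral>\<^sup>+x. h x * indicator (A k) x \<partial>lborel) \<le> ennreal (c * r powr g * (a powr g) ^ k)" .
    qed
    also have "\<dots> = ennreal (c * r powr g * (1 / (1 - a powr g)))"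
      using a \<open>c \<ge> 0\<close>
      by (intro suminf_ennreal_eq sums_mult geometric_sums) (auto simp: g_def)
    also have "\<dots> \<le> ennreal (C * r powr g)"
      by (intro ennreal_leI) (simp add: C_def algebra_simps)
    finally show "(\<integral>\<^sup>+x. W x * ennreal (norm x powr b) * indicator S x \<partial>lborel)
        \<le> ennreal (C * r powr (b + DIM('a)))"
      by (simp add: h_def g_def)
  qed
qed

lemma nn_integral_homogeneous_near:
  fixes W :: "'a::euclidean_space \<Rightarrow> ennreal" and b :: real
  assumes W: "W \<in> borel_measurable borel" "\<forall>t>0. \<forall>x. W (t *\<^sub>R x) = W x"
      "(\<integral>\<^sup>+x. W x * indicator (ball 0 1) x \<partial>lborel) < top"
    and b: "b + DIM('a) > 0"
  obtains C where "C > 0"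
    "\<And>r. r > 0 \<Longrightarrow> (\<integral>\<^sup>+x. W x * ennreal (norm x powr b) * indicator (ball 0 r) x \<partial>lborel)
        \<le> ennreal (C * r powr (b + DIM('a)))"
proof -
  have a: "(1/2::real) > 0" "(1/2) powr (b + DIM('a)) < 1"
    using b powr_less_mono2[of "b + DIM('a)" "1/2" 1] by simp_all
  obtain C where C: "C > 0" "\<forall>r>0. \<forall>S. S \<in> sets borel \<and> 0 \<notin> S \<and>
        (\<forall>x\<in>S. \<exists>k::nat. r * (1/2) ^ k \<le> norm x \<and> norm x < 2 * (r * (1/2) ^ k)) \<longrightarrow>
       (\<integral>\<^sup>+x. W x * ennreal (norm x powr b) * indicator S x \<partial>lborel)
        \<le> ennreal (C * r powr (b + DIM('a)))"
    using nn_integral_homogeneous_annuli[OF W a] by (elim exE conjE)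
  show ?thesis
  proof (rule that[of C])
    fix r :: real assume r: "r > 0"
    \<comment> \<open>The origin lies in no annulus; removing it costs nothing because
      \<open>0 powr b = 0\<close>.\<close>
    have "(\<integral>\<^sup>+x. W x * ennreal (norm x powr b) * indicator (ball 0 r) x \<partial>lborel)
        = (\<integral>\<^sup>+x. W x * ennreal (norm x powr b) * indicator (ball 0 r - {0}) x \<partial>lborel)"
      by (intro nn_integral_cong) (auto simp: indicator_def)
    \<comment> \<open>The outermost annulus reaches from \<open>r / 2\<close> to \<open>r\<close>,
      hence the halved starting radius.\<close>
    also have "\<dots> \<le> ennreal (C * (r / 2) powr (b + DIM('a)))"
    proof (rule C(2)[rule_format]; (intro conjI ballI)?)
      fix x :: 'a assume x: "x \<in> ball 0 r - {0}"
      then obtain m where "(1/2) ^ m < norm x / r"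
        using real_arch_pow_inv[of "norm x / r" "1/2"] r by auto
      then have ex: "r * (1/2) ^ m \<le> 2 * norm x"
        using r by (simp add: field_simps)
      \<comment> \<open>Minimality supplies the outer bound: the preceding index violates the
        inequality, and the outer radius of annulus \<open>k\<close> is the inner radius of annulus
        \<open>k - 1\<close>.\<close>
      define k where "k = (LEAST m. r / 2 * (1/2) ^ m \<le> norm x)"
      have k: "r / 2 * (1/2) ^ k \<le> norm x"
        unfolding k_def by (rule LeastI[of _ m]) (use ex in simp)
      moreover have "norm x < 2 * (r / 2 * (1/2) ^ k)"
      proof (cases k)
        case 0 then show ?thesis using x by auto
      next
        case (Suc l)
        then have "\<not> r / 2 * (1/2) ^ l \<le> norm x"
          unfolding k_def by (metis not_less_Least lessI)
        then show ?thesis using Suc by simp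
      qed
      ultimately show "\<exists>k::nat. r / 2 * (1/2) ^ k \<le> norm x \<and> norm x < 2 * (r / 2 * (1/2) ^ k)"
        by blast
    qed (use r in auto)
    also have "\<dots> \<le> ennreal (C * r powr (b + DIM('a)))"
      using r C(1) b by (intro ennreal_leI mult_left_mono powr_mono2) auto
    finally show "(\<integral>\<^sup>+x. W x * ennreal (norm x powr b) * indicator (ball 0 r) x \<partial>lborel)
        \<le> ennreal (C * r powr (b + DIM('a)))" .
  qed (rule C(1))
qed

lemma nn_integral_homogeneous_far:
  fixes W :: "'a::euclidean_space \<Rightarrow> ennreal" and b :: real
  assumes W: "W \<in> borel_measurable borel" "\<forall>t>0. \<forall>x. W (t *\<^sub>R x) = W x"
      "(\<integral>\<^sup>+x. W x * indicator (ball 0 1) x \<partial>lborel) < top"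
    and b: "b + DIM('a) < 0"
  obtains C where "C > 0"
    "\<And>r. r > 0 \<Longrightarrow> (\<integral>\<^sup>+x. W x * ennreal (norm x powr b) * indicator (- ball 0 r) x \<partial>lborel)
        \<le> ennreal (C * r powr (b + DIM('a)))"
proof -
  have a: "(2::real) > 0" "2 powr (b + DIM('a)) < 1"
    using powr_less_mono[OF b, of 2] by (simp, simp)
  obtain C where C: "C > 0" "\<forall>r>0. \<forall>S. S \<in> sets borel \<and> 0 \<notin> S \<and>
        (\<forall>x\<in>S. \<exists>k::nat. r * 2 ^ k \<le> norm x \<and> norm x < 2 * (r * 2 ^ k)) \<longrightarrow>
       (\<integral>\<^sup>+x. W x * ennreal (norm x powr b) * indicator S x \<partial>lborel)
        \<le> ennreal (C * r powr (b + DIM('a)))"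
    using nn_integral_homogeneous_annuli[OF W a] by (elim exE conjE)
  show ?thesis
  proof (rule that[of C])
    fix r :: real assume r: "r > 0"
    show "(\<integral>\<^sup>+x. W x * ennreal (norm x powr b) * indicator (- ball 0 r) x \<partial>lborel)
        \<le> ennreal (C * r powr (b + DIM('a)))"
    proof (rule C(2)[rule_format]; (intro conjI ballI)?)
      fix x :: 'a assume x: "x \<in> - ball 0 r"
      obtain m where m: "norm x / r < 2 ^ m"
        using real_arch_pow[of 2 "norm x / r"] by auto
      have ex: "norm x < 2 * (r * 2 ^ m)"
      proof -
        have "norm x < r * 2 ^ m" using m r by (simp add: pos_divide_less_eq mult.commute)
        also have "\<dots> \<le> 2 * (r * 2 ^ m)" using r by simp
        finally show ?thesis .
      qed
      define k where "k = (LEAST m. norm x < 2 * (r * 2 ^ m))"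
      have k: "norm x < 2 * (r * 2 ^ k)"
        unfolding k_def by (rule LeastI[of _ m]) (use ex in simp)
      moreover have "r * 2 ^ k \<le> norm x"
      proof (cases k)
        case 0 then show ?thesis using x by auto
      next
        case (Suc l)
        then have "\<not> norm x < 2 * (r * 2 ^ l)"
          unfolding k_def by (metis not_less_Least lessI)
        then show ?thesis using Suc by simp
      qed
      ultimately show "\<exists>k::nat. r * 2 ^ k \<le> norm x \<and> norm x < 2 * (r * 2 ^ k)"
        by blast
    qed (use r in auto)
  qed (rule C(1))
qed

section \<open>Nonnegative convolutions: level sets, weak type and strong type\<close>

text \<open>Extended values give the integral a meaning before any convergence is known and leave
  Tonelli and monotonicity freely available.\<close>

definition nn_convolution :: "('a::euclidean_space \<Rightarrow> ennreal) \<Rightarrow> ('a \<Rightarrow> real) \<Rightarrow> 'a \<Rightarrow> ennreal" where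
  "nn_convolution K u x = (\<integral>\<^sup>+y. K (x - y) * ennreal (u y) \<partial>lborel)"

lemma borel_measurable_nn_convolution [measurable]:
  assumes [measurable]: "K \<in> borel_measurable borel" "u \<in> borel_measurable borel"
  shows "nn_convolution K u \<in> borel_measurable borel"
  unfolding nn_convolution_def[abs_def] by measurable

lemma nn_integral_nn_convolution:
  fixes K :: "'a::euclidean_space \<Rightarrow> ennreal"
  assumes [measurable]: "K \<in> borel_measurable borel" "u \<in> borel_measurable borel"
  shows "(\<integral>\<^sup>+x. nn_convolution K u x \<partial>lborel) = (\<integral>\<^sup>+x. K x \<partial>lborel) * (\<integral>\<^sup>+y. ennreal (u y) \<partial>lborel)"
proof -
  have "(\<integral>\<^sup>+x. nn_convolution K u x \<partial>lborel) = (\<integral>\<^sup>+y. (\<integral>\<^sup>+x. K (x - y) * ennreal (u y) \<partial>lborel) \<partial>lborel)"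
    unfolding nn_convolution_def by (intro lborel_pair.Fubini') measurable
  also have "\<dots> = (\<integral>\<^sup>+y. (\<integral>\<^sup>+x. K x \<partial>lborel) * ennreal (u y) \<partial>lborel)"
    by (intro nn_integral_cong) (simp add: nn_integral_multc nn_integral_lborel_shift)
  also have "\<dots> = (\<integral>\<^sup>+x. K x \<partial>lborel) * (\<integral>\<^sup>+y. ennreal (u y) \<partial>lborel)"
    by (simp add: nn_integral_cmult)
  finally show ?thesis .
qed

lemma emeasure_Markov:
  fixes g :: "'a::euclidean_space \<Rightarrow> ennreal" and l :: real
  assumes [measurable]: "g \<in> borel_measurable borel" and "l > 0"
  shows "emeasure lborel {x. ennreal l < g x} \<le> ennreal (1 / l) * (\<integral>\<^sup>+x. g x \<partial>lborel)"
proof -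
  have "emeasure lborel {x. ennreal l < g x} \<le> emeasure lborel {x\<in>UNIV. 1 \<le> ennreal (1 / l) * g x}"
  proof (intro emeasure_mono subsetI)
    fix x assume "x \<in> {x. ennreal l < g x}"
    then have "ennreal (1 / l) * ennreal l \<le> ennreal (1 / l) * g x"
      by (intro mult_left_mono) auto
    then show "x \<in> {x\<in>UNIV. 1 \<le> ennreal (1 / l) * g x}"
      using \<open>l > 0\<close> by (simp add: ennreal_mult''[symmetric])
  qed simp
  also have "\<dots> \<le> ennreal (1 / l) * (\<integral>\<^sup>+x. g x * indicator UNIV x \<partial>lborel)"
    by (rule nn_integral_Markov_inequality) auto
  finally show ?thesis by simp
qed

text \<open>The far part of the kernel and the small values of \<open>u\<close> each contribute at most \<open>l\<close>;
  only the near part acting on the large values is estimated in measure.\<close>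

lemma emeasure_nn_convolution_le:
  fixes K :: "'a::euclidean_space \<Rightarrow> ennreal" and l h A r :: real
  assumes K [measurable]: "K \<in> borel_measurable borel"
    and u [measurable]: "u \<in> borel_measurable borel"
    and near: "(\<integral>\<^sup>+x. K x * indicator (ball 0 r) x \<partial>lborel) \<le> ennreal A"
    and far: "\<And>x. (\<integral>\<^sup>+y. K (x - y) * ennreal (u y) * indicator (- ball 0 r) (x - y) \<partial>lborel) \<le> ennreal l"
    and l: "l > 0" and h: "h > 0" "A * h \<le> l" and A: "A \<ge> 0"
  shows "emeasure lborel {x. ennreal (3 * l) < nn_convolution K u x}
     \<le> ennreal (A / l) * (\<integral>\<^sup>+y. ennreal (u y) * indicator {h<..} (u y) \<partial>lborel)"
proof -
  define Kn where "Kn x = K x * indicator (ball 0 r) x" for x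
  have B[measurable]: "(\<lambda>x. indicator (ball 0 r) x :: ennreal) \<in> borel_measurable (borel :: 'a measure)"
    by (intro borel_measurable_indicator) simp
  have B'[measurable]: "(\<lambda>x. indicator (- ball 0 r) x :: ennreal) \<in> borel_measurable (borel :: 'a measure)"
    by (intro borel_measurable_indicator) simp
  have Kn[measurable]: "Kn \<in> borel_measurable borel" unfolding Kn_def[abs_def] by measurable
  define v where "v y = u y * indicator {h<..} (u y)" for y
  have v[measurable]: "v \<in> borel_measurable borel" unfolding v_def[abs_def] by measurable
  have le: "nn_convolution K u x \<le> ennreal l + (ennreal l + nn_convolution Kn v x)" for x
  proof -
    have "nn_convolution K u x \<le>
       (\<integral>\<^sup>+y. K (x - y) * ennreal (u y) * indicator (- ball 0 r) (x - y)
           + (Kn (x - y) * ennreal h + Kn (x - y) * ennreal (v y)) \<partial>lborel)"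
      unfolding nn_convolution_def
    proof (rule nn_integral_mono)
      fix y
      have "ennreal (u y) \<le> ennreal h + ennreal (v y)"
        using h by (cases "u y > h") (auto simp: v_def intro: ennreal_leI)
      then have "K (x - y) * ennreal (u y) \<le> K (x - y) * ennreal h + K (x - y) * ennreal (v y)"
        by (simp add: distrib_left[symmetric] mult_left_mono)
      then show "K (x - y) * ennreal (u y) \<le> K (x - y) * ennreal (u y) * indicator (- ball 0 r) (x - y)
           + (Kn (x - y) * ennreal h + Kn (x - y) * ennreal (v y))"
        by (cases "x - y \<in> ball 0 r") (simp_all add: Kn_def del: mem_ball)
    qed
    also have "\<dots> = (\<integral>\<^sup>+y. K (x - y) * ennreal (u y) * indicator (- ball 0 r) (x - y) \<partial>lborel)
           + ((\<integral>\<^sup>+y. Kn (x - y) * ennreal h \<partial>lborel) + nn_convolution Kn v x)"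
      unfolding nn_convolution_def
      by (simp add: nn_integral_add)
    also have "\<dots> \<le> ennreal l + (ennreal l + nn_convolution Kn v x)"
    proof (intro add_mono order.refl far)
      have "(\<integral>\<^sup>+y. Kn (x - y) * ennreal h \<partial>lborel) = (\<integral>\<^sup>+y. Kn y \<partial>lborel) * ennreal h"
        using nn_integral_lborel_reflect[of Kn x] by (simp add: nn_integral_multc)
      also have "\<dots> \<le> ennreal A * ennreal h"
        using near by (intro mult_right_mono) (auto simp: Kn_def)
      also have "\<dots> \<le> ennreal l"
        using h A by (simp add: ennreal_mult''[symmetric] ennreal_leI)
      finally show "(\<integral>\<^sup>+y. Kn (x - y) * ennreal h \<partial>lborel) \<le> ennreal l" .
    qed
    finally show ?thesis .
  qed
  have "emeasure lborel {x. ennreal (3 * l) < nn_convolution K u x}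
      \<le> emeasure lborel {x. ennreal l < nn_convolution Kn v x}"
  proof (intro emeasure_mono subsetI)
    fix x assume "x \<in> {x. ennreal (3 * l) < nn_convolution K u x}"
    then have "ennreal l + (ennreal l + ennreal l) < ennreal l + (ennreal l + nn_convolution Kn v x)"
      using le[of x] l by (simp add: ennreal_plus[symmetric] del: ennreal_plus)
    \<comment> \<open>Cancelling is legitimate because \<open>ennreal l\<close> is finite.\<close>
    then show "x \<in> {x. ennreal l < nn_convolution Kn v x}"
      by (simp add: ennreal_add_left_cancel_less)
  qed simp
  also have "\<dots> \<le> ennreal (1 / l) * (\<integral>\<^sup>+x. nn_convolution Kn v x \<partial>lborel)"
    using l by (intro emeasure_Markov) auto
  also have "\<dots> \<le> ennreal (1 / l) * (ennreal A * (\<integral>\<^sup>+y. ennreal (v y) \<partial>lborel))"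
    using near by (simp add: nn_integral_nn_convolution Kn_def[abs_def] mult_left_mono mult_right_mono)
  also have "\<dots> = ennreal (A / l) * (\<integral>\<^sup>+y. ennreal (v y) \<partial>lborel)"
    using l A by (simp add: mult.assoc[symmetric] ennreal_mult''[symmetric])
  also have "(\<integral>\<^sup>+y. ennreal (v y) \<partial>lborel) = (\<integral>\<^sup>+y. ennreal (u y) * indicator {h<..} (u y) \<partial>lborel)"
    by (intro nn_integral_cong) (auto simp: v_def indicator_def)
  finally show ?thesis .
qed

text \<open>The radius solves \<open>B * r powr (- n / q) = l\<close>. The largest height at which
  the near part still contributes at most \<open>l\<close> is then
  \<open>l / (A * r powr \<alpha>)\<close>, a multiple of
  \<open>l powr (1 + q * \<alpha> / n)\<close>. The relation between \<open>p\<close> and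
  \<open>q\<close> makes this exponent \<open>q / p\<close>, and the multiple is \<open>D\<close>;
  the factor before the integral is the reciprocal of the height.\<close>

lemma emeasure_fractional_convolution_le:
  fixes K :: "'a::euclidean_space \<Rightarrow> ennreal" and u :: "'a \<Rightarrow> real" and A B \<alpha> p q n :: real
  assumes K: "K \<in> borel_measurable borel" and u: "u \<in> borel_measurable borel"
    and near: "\<And>r. r > 0 \<Longrightarrow> (\<integral>\<^sup>+x. K x * indicator (ball 0 r) x \<partial>lborel) \<le> ennreal (A * r powr \<alpha>)"
    and far: "\<And>r x. r > 0 \<Longrightarrow>
       (\<integral>\<^sup>+y. K (x - y) * ennreal (u y) * indicator (- ball 0 r) (x - y) \<partial>lborel) \<le> ennreal (B * r powr (- n / q))"
    and "A > 0" "B > 0" and n: "n > 0" and q: "q > 0" and p: "p > 0" and pq: "1 / q = 1 / p - \<alpha> / n"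
    and l: "l > 0"
    and D: "D = 1 / (A * B powr (q * \<alpha> / n))"
  shows "emeasure lborel {x. ennreal (3 * l) < nn_convolution K u x}
     \<le> ennreal (1 / (D * l powr (q / p))) *
        (\<integral>\<^sup>+y. ennreal (u y) * indicator {D * l powr (q / p)<..} (u y) \<partial>lborel)"
proof -
  define r where "r = (B / l) powr (q / n)"
  have r: "r > 0" using \<open>B > 0\<close> l by (simp add: r_def)
  have "q / p = 1 + q * \<alpha> / n"
    using pq q p n by (simp add: field_simps)
  then have "D * l powr (q / p) = l / (A * r powr \<alpha>)"
    using \<open>A > 0\<close> \<open>B > 0\<close> l q n by (simp add: D r_def powr_powr powr_divide powr_add)
  moreover have "B * r powr (- n / q) = l"
    using \<open>B > 0\<close> l q n by (simp add: r_def powr_powr powr_minus)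
  ultimately show ?thesis
    using emeasure_nn_convolution_le[OF K u near[OF r], of l "l / (A * r powr \<alpha>)"] far[OF r] r \<open>A > 0\<close> l
    by simp
qed

text \<open>Where \<open>u > h\<close> one has \<open>u / h \<le> (u / h) powr p\<close>, so the
  truncated integral divided by \<open>h\<close> is at most \<open>h powr (- p)\<close> times the
  integral of \<open>u powr p\<close>. With \<open>h\<close> of order \<open>l powr (q / p)\<close>
  this is of order \<open>l powr (- q)\<close>.\<close>

lemma weak_type_nn_convolution:
  fixes K :: "'a::euclidean_space \<Rightarrow> ennreal" and u :: "'a \<Rightarrow> real" and D p q l :: real
  assumes u [measurable]: "u \<in> borel_measurable borel" and u0: "\<And>x. u x \<ge> 0"
    and le: "\<And>l. l > 0 \<Longrightarrow> emeasure lborel {x. ennreal (3 * l) < nn_convolution K u x}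
     \<le> ennreal (1 / (D * l powr (q / p))) *
        (\<integral>\<^sup>+y. ennreal (u y) * indicator {D * l powr (q / p)<..} (u y) \<partial>lborel)"
    and "D > 0" and p: "p \<ge> 1" and "q > 0"
    and int: "(\<integral>\<^sup>+x. ennreal (u x powr p) \<partial>lborel) \<le> 1" and l: "l > 0"
  shows "emeasure lborel {x. ennreal l < nn_convolution K u x} \<le> ennreal (D powr (- p) * 3 powr q * l powr (- q))"
proof -
  \<comment> \<open>The level-set estimate speaks of \<open>3 * l\<close>, so it is applied at a
    third of the level.\<close>
  define h where "h = D * (l / 3) powr (q / p)"
  have h: "h > 0" using \<open>D > 0\<close> l by (simp add: h_def)
  have "emeasure lborel {x. ennreal l < nn_convolution K u x} \<le>
      ennreal (1 / h) * (\<integral>\<^sup>+y. ennreal (u y) * indicator {h<..} (u y) \<partial>lborel)"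
    using le[of "l / 3"] l by (simp add: h_def)
  also have "\<dots> = (\<integral>\<^sup>+y. ennreal (1 / h) * (ennreal (u y) * indicator {h<..} (u y)) \<partial>lborel)"
    by (rule nn_integral_cmult[symmetric]) measurable
  also have "\<dots> \<le> (\<integral>\<^sup>+y. ennreal (h powr (- p)) * ennreal (u y powr p) \<partial>lborel)"
  proof (rule nn_integral_mono)
    fix y
    show "ennreal (1 / h) * (ennreal (u y) * indicator {h<..} (u y)) \<le> ennreal (h powr (- p)) * ennreal (u y powr p)"
    proof (cases "u y > h")
      case True
      then have "(u y / h) powr 1 \<le> (u y / h) powr p"
        using h p by (intro powr_mono) auto
      then have "1 / h * u y \<le> h powr (- p) * u y powr p"
        using True h powr_divide[of "u y" h p] by (simp add: powr_minus_divide)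
      then show ?thesis
        using True h u0[of y] by (simp add: ennreal_mult''[symmetric] ennreal_leI)
    qed simp
  qed
  also have "\<dots> = ennreal (h powr (- p)) * (\<integral>\<^sup>+x. ennreal (u x powr p) \<partial>lborel)"
    by (rule nn_integral_cmult) measurable
  also have "\<dots> \<le> ennreal (h powr (- p))"
    using mult_left_mono[OF int, of "ennreal (h powr (- p))"] by simp
  also have "h powr (- p) = D powr (- p) * 3 powr q * l powr (- q)"
    using \<open>D > 0\<close> l p by (simp add: h_def powr_mult powr_powr powr_divide powr_minus_divide)
  finally show ?thesis .
qed

lemma nn_integral_powr_interval:
  fixes a c :: real
  assumes a: "a > 0" and c: "c \<ge> 0"
  shows "(\<integral>\<^sup>+t. ennreal (t powr (a - 1)) * indicator {0<..<c} t \<partial>lborel) = ennreal (c powr a / a)"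
proof -
  have "(\<integral>\<^sup>+t. ennreal (t powr (a - 1)) * indicator {0<..<c} t \<partial>lborel)
      = (\<integral>\<^sup>+t. ennreal (t powr (a - 1)) * indicator {0..c} t \<partial>lborel)"
    using AE_lborel_singleton[of 0] AE_lborel_singleton[of c]
    by (intro nn_integral_cong_AE, eventually_elim) (auto simp: indicator_def)
  also have "\<dots> = ennreal (c powr (a - 1 + 1) / (a - 1 + 1))"
    using a c by (intro nn_integral_has_integral_lebesgue' has_integral_powr_from_0) auto
  finally show ?thesis by simp
qed

text \<open>Layer-cake integration of the level-set estimate. After the exchange each
  \<open>u y\<close> sees the levels \<open>t < (u y / D) powr (p / q)\<close> with density
  \<open>t powr (q - q / p - 1)\<close>, integrable at 0 because \<open>p > 1\<close>. The result is
  of order \<open>u y powr (p - 1)\<close>, and the remaining factor \<open>u y\<close> completes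
  the power \<open>p\<close>. The real-valued \<open>v\<close> stands for the modulus of the
  operator, since the convolution may be infinite at some points.\<close>

lemma strong_type_nn_convolution:
  fixes K :: "'a::euclidean_space \<Rightarrow> ennreal" and u v :: "'a \<Rightarrow> real" and D p q :: real
  assumes u [measurable]: "u \<in> borel_measurable borel" and u0: "\<And>x. u x \<ge> 0"
    and v [measurable]: "v \<in> borel_measurable borel" and v0: "\<And>x. v x \<ge> 0"
    and K [measurable]: "K \<in> borel_measurable borel"
    and vle: "\<And>x. ennreal (v x) \<le> nn_convolution K u x"
    and le: "\<And>l. l > 0 \<Longrightarrow> emeasure lborel {x. ennreal (3 * l) < nn_convolution K u x}
     \<le> ennreal (1 / (D * l powr (q / p))) *
        (\<integral>\<^sup>+y. ennreal (u y) * indicator {D * l powr (q / p)<..} (u y) \<partial>lborel)"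
    and D: "D > 0" and p: "p > 1" and q: "q > 0"
    and int: "(\<integral>\<^sup>+x. ennreal (u x powr p) \<partial>lborel) \<le> 1"
  shows "(\<integral>\<^sup>+x. ennreal (v x powr q) \<partial>lborel) \<le> ennreal (3 powr q * q / (D powr p * (q - q / p)))"
proof -
  define w where "w x = v x / 3" for x
  have w[measurable]: "w \<in> borel_measurable borel" unfolding w_def[abs_def] by measurable
  have w0: "w x \<ge> 0" for x using v0 by (simp add: w_def)
  define a where "a = q - q / p"
  have a: "a > 0" using p q by (simp add: a_def field_simps)
  have "(\<integral>\<^sup>+x. ennreal (w x powr q) \<partial>lborel) =
      (\<integral>\<^sup>+x. (\<integral>\<^sup>+t. ennreal q * (ennreal (t powr (q - 1)) * indicator {0<..<w x} t) \<partial>lborel) \<partial>lborel)"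
    using q w0 by (intro nn_integral_cong)
      (simp add: nn_integral_cmult nn_integral_powr_interval ennreal_mult''[symmetric])
  also have "\<dots> = (\<integral>\<^sup>+t. (\<integral>\<^sup>+x. ennreal q * (ennreal (t powr (q - 1)) * indicator {0<..<w x} t) \<partial>lborel) \<partial>lborel)"
    by (rule lborel_pair.Fubini') (simp add: indicator_def)
  also have "\<dots> \<le> (\<integral>\<^sup>+t. (\<integral>\<^sup>+y. ennreal (q / D) * ennreal (u y) *
       (ennreal (t powr (a - 1)) * indicator {0<..<(u y / D) powr (p / q)} t) \<partial>lborel) \<partial>lborel)"
  proof (rule nn_integral_mono)
    fix t :: real
    show "(\<integral>\<^sup>+x. ennreal q * (ennreal (t powr (q - 1)) * indicator {0<..<w x} t) \<partial>lborel)
       \<le> (\<integral>\<^sup>+y. ennreal (q / D) * ennreal (u y) *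
       (ennreal (t powr (a - 1)) * indicator {0<..<(u y / D) powr (p / q)} t) \<partial>lborel)"
    proof (cases "t > 0")
      case t: True
      have "(\<integral>\<^sup>+x. ennreal q * (ennreal (t powr (q - 1)) * indicator {0<..<w x} t) \<partial>lborel)
         = (\<integral>\<^sup>+x. ennreal (q * t powr (q - 1)) * indicator {x. t < w x} x \<partial>lborel)"
        using t q by (intro nn_integral_cong) (auto simp: indicator_def ennreal_mult'')
      also have "\<dots> = ennreal (q * t powr (q - 1)) * emeasure lborel {x. t < w x}"
        by (simp add: nn_integral_cmult_indicator)
      also have "\<dots> \<le> ennreal (q * t powr (q - 1)) * emeasure lborel {x. ennreal (3 * t) < nn_convolution K u x}"
      proof (intro mult_left_mono emeasure_mono subsetI)
        fix x assume "x \<in> {x. t < w x}"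
        then have "ennreal (3 * t) < ennreal (v x)"
          using t by (intro ennreal_lessI) (auto simp: w_def)
        then show "x \<in> {x. ennreal (3 * t) < nn_convolution K u x}"
          using vle[of x] by auto
      qed auto
      also have "\<dots> \<le> ennreal (q * t powr (q - 1)) * (ennreal (1 / (D * t powr (q / p))) *
        (\<integral>\<^sup>+y. ennreal (u y) * indicator {D * t powr (q / p)<..} (u y) \<partial>lborel))"
        by (intro mult_left_mono le t) auto
      also have "\<dots> = ennreal (q / D * t powr (a - 1)) *
        (\<integral>\<^sup>+y. ennreal (u y) * indicator {D * t powr (q / p)<..} (u y) \<partial>lborel)"
      proof -
        have "t powr (a - 1) = t powr (q - 1) / t powr (q / p)"
          using t by (simp add: a_def powr_diff[symmetric] algebra_simps)
        then have "q * t powr (q - 1) * (1 / (D * t powr (q / p))) = q / D * t powr (a - 1)"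
          by simp
        then show ?thesis
          using D t q by (simp add: mult.assoc[symmetric] ennreal_mult''[symmetric])
      qed
      also have "\<dots> = (\<integral>\<^sup>+y. ennreal (q / D * t powr (a - 1)) * (ennreal (u y) * indicator {D * t powr (q / p)<..} (u y)) \<partial>lborel)"
        by (rule nn_integral_cmult[symmetric]) measurable
      also have "\<dots> = (\<integral>\<^sup>+y. ennreal (q / D) * ennreal (u y) *
         (ennreal (t powr (a - 1)) * indicator {0<..<(u y / D) powr (p / q)} t) \<partial>lborel)"
      proof (rule nn_integral_cong)
        fix y
        \<comment> \<open>Solving the cut for \<open>t\<close> turns a condition on
          \<open>u y\<close> into an upper limit for the level, which makes the inner integral
          explicit after the exchange.\<close>
        have "D * t powr (q / p) < u y \<longleftrightarrow> t < (u y / D) powr (p / q)"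
        proof -
          have "D * t powr (q / p) < u y \<longleftrightarrow> t powr (q / p) < u y / D"
            using D by (simp add: field_simps)
          also have "\<dots> \<longleftrightarrow> (t powr (q / p)) powr (p / q) < (u y / D) powr (p / q)"
            using p q u0[of y] D powr_less_mono2[of "p / q" "t powr (q / p)" "u y / D"]
              powr_mono2[of "p / q" "u y / D" "t powr (q / p)"] by force
          also have "(t powr (q / p)) powr (p / q) = t"
            using t p q by (simp add: powr_powr)
          finally show ?thesis .
        qed
        then show "ennreal (q / D * t powr (a - 1)) * (ennreal (u y) * indicator {D * t powr (q / p)<..} (u y))
          = ennreal (q / D) * ennreal (u y) *
         (ennreal (t powr (a - 1)) * indicator {0<..<(u y / D) powr (p / q)} t)"
          using t by (simp add: indicator_def ennreal_mult''[of "t powr (a - 1)" "q / D"] mult_ac del: times_divide_eq_left)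
      qed
      finally show ?thesis .
    qed simp
  qed
  also have "\<dots> = (\<integral>\<^sup>+y. (\<integral>\<^sup>+t. ennreal (q / D) * ennreal (u y) *
       (ennreal (t powr (a - 1)) * indicator {0<..<(u y / D) powr (p / q)} t) \<partial>lborel) \<partial>lborel)"
    by (rule lborel_pair.Fubini'[symmetric]) (simp add: indicator_def)
  also have "\<dots> = (\<integral>\<^sup>+y. ennreal (q / (D powr p * a)) * ennreal (u y powr p) \<partial>lborel)"
  proof (rule nn_integral_cong)
    fix y
    have "(\<integral>\<^sup>+t. ennreal (q / D) * ennreal (u y) *
       (ennreal (t powr (a - 1)) * indicator {0<..<(u y / D) powr (p / q)} t) \<partial>lborel)
      = ennreal (q / D) * ennreal (u y) * ennreal (((u y / D) powr (p / q)) powr a / a)"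
      using a by (simp add: nn_integral_cmult nn_integral_powr_interval)
    also have "\<dots> = ennreal (q / D * u y * (((u y / D) powr (p / q)) powr a / a))"
      using a D q u0[of y] by (simp add: ennreal_mult''[symmetric])
    \<comment> \<open>The exponents multiply to
      \<open>(p / q) * (q - q / p) = p - 1\<close>.\<close>
    also have "((u y / D) powr (p / q)) powr a = (u y / D) powr (p - 1)"
      using p q by (simp add: powr_powr a_def right_diff_distrib)
    also have "q / D * u y * ((u y / D) powr (p - 1) / a) = q / (D powr p * a) * u y powr p"
    proof (cases "u y = 0")
      case False
      then have uy: "u y > 0" using u0[of y] by simp
      then have "u y powr p = u y * u y powr (p - 1)" "D powr p = D * D powr (p - 1)"
        using D by (simp_all add: powr_diff)
      then show ?thesis using uy D by (simp add: powr_divide)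
    qed simp
    finally show "(\<integral>\<^sup>+t. ennreal (q / D) * ennreal (u y) *
       (ennreal (t powr (a - 1)) * indicator {0<..<(u y / D) powr (p / q)} t) \<partial>lborel)
      = ennreal (q / (D powr p * a)) * ennreal (u y powr p)"
      by (simp only: ennreal_mult''[OF powr_ge_zero])
  qed
  also have "\<dots> \<le> ennreal (q / (D powr p * a))"
    using mult_left_mono[OF int, of "ennreal (q / (D powr p * a))"] by (simp add: nn_integral_cmult)
  finally have *: "(\<integral>\<^sup>+x. ennreal (w x powr q) \<partial>lborel) \<le> ennreal (q / (D powr p * a))" .
  have "(\<integral>\<^sup>+x. ennreal (v x powr q) \<partial>lborel) = (\<integral>\<^sup>+x. ennreal (3 powr q) * ennreal (w x powr q) \<partial>lborel)"
    using v0 by (intro nn_integral_cong) (simp add: w_def powr_divide ennreal_mult''[symmetric])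
  also have "\<dots> = ennreal (3 powr q) * (\<integral>\<^sup>+x. ennreal (w x powr q) \<partial>lborel)"
    by (simp add: nn_integral_cmult)
  also have "\<dots> \<le> ennreal (3 powr q) * ennreal (q / (D powr p * a))"
    by (intro mult_left_mono *) auto
  finally show ?thesis
    using a D q by (simp add: ennreal_mult''[symmetric] a_def)
qed

section \<open>Borel representatives and the cone measure on the sphere\<close>

lemma exists_borel_representative:
  fixes f :: "'a \<Rightarrow> complex"
  assumes "f \<in> borel_measurable (completion M)"
  obtains g where "g \<in> borel_measurable M" "AE x in M. f x = g x"
proof -
  have "(\<lambda>x. Re (f x)) \<in> borel_measurable (completion M)" "(\<lambda>x. Im (f x)) \<in> borel_measurable (completion M)"
    using assms by measurable
  from this[THEN completion_ex_borel_measurable_real] obtain a b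
    where [measurable]: "a \<in> borel_measurable M" "b \<in> borel_measurable M"
      and "AE x in M. Re (f x) = a x" "AE x in M. Im (f x) = b x"
    by blast
  then have "AE x in M. f x = complex_of_real (a x) + \<i> * complex_of_real (b x)"
    by (auto simp: complex_eq_iff)
  moreover have "(\<lambda>x. complex_of_real (a x) + \<i> * complex_of_real (b x)) \<in> borel_measurable M"
    by measurable
  ultimately show ?thesis by (rule that[rotated])
qed

text \<open>The cone measure says that the cone over \<open>N\<close> has no volume inside the unit
  ball. Its indicator is invariant under dilations, so scaling gives the same in every ball of
  positive integer radius, and countably many of these exhaust the space.\<close>

lemma AE_sgn_notin_sphere_null:
  fixes N :: "'a::euclidean_space set"
  assumes N: "N \<in> sets borel" "N \<subseteq> sphere 0 1" and null: "emeasure sphere_measure N = 0"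
  shows "AE x in lborel. sgn x \<notin> N"
proof -
  have sgn [measurable]: "(sgn :: 'a \<Rightarrow> 'a) \<in> borel_measurable borel"
    unfolding sgn_div_norm by measurable
  define C where "C = {x. sgn x \<in> N}"
  have C [measurable]: "C \<in> sets borel"
    using N(1) by (simp add: C_def)
  have "emeasure lborel (C \<inter> ball 0 1) = 0"
  proof -
    have "C \<inter> ball 0 1 = {x \<in> ball 0 1 - {0}. sgn x \<in> N}"
      using N(2) by (auto simp: C_def)
    moreover have "emeasure lborel {x \<in> ball 0 1 - {0}. sgn x \<in> N} / emeasure lborel (ball (0::'a) 1) = 0"
      using emeasure_sphere_measure[OF N] null by simp
    ultimately show ?thesis
      using less_imp_neq[OF emeasure_lborel_ball_finite[of "0::'a" 1]] by simp
  qed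
  then have 0: "(\<integral>\<^sup>+x. indicator C x * indicator (ball 0 1) x \<partial>lborel) = 0"
    by (simp add: indicator_inter_arith[symmetric])
  have hom: "\<forall>t>0. \<forall>x. indicator C (t *\<^sub>R x) = (indicator C x :: ennreal)"
    by (auto simp: C_def indicator_def sgn_scaleR)
  have "AE x in lborel. x \<notin> C \<inter> ball 0 (real (Suc k))" for k
  proof -
    have "emeasure lborel (C \<inter> ball 0 (real (Suc k))) = (\<integral>\<^sup>+x. indicator C x * indicator (ball 0 (real (Suc k))) x \<partial>lborel)"
      by (simp add: indicator_inter_arith[symmetric])
    also have "\<dots> = 0"
      using nn_integral_homogeneous_ball[OF borel_measurable_indicator[OF C] hom, of "real (Suc k)"] 0 by simp
    finally show ?thesis
      by (intro AE_not_in null_setsI) auto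
  qed
  then have "AE x in lborel. \<forall>k. x \<notin> C \<inter> ball 0 (real (Suc k))"
    by (subst AE_all_countable) blast
  then show ?thesis
  proof eventually_elim
    case (elim x)
    obtain k where "norm x < real (Suc k)"
      using reals_Archimedean2[of "norm x"] by (metis less_Suc_eq of_nat_less_iff order_less_trans)
    then show ?case using elim by (auto simp: C_def)
  qed
qed

lemma enn_powr_less_top_iff: "enn_powr a r < top \<longleftrightarrow> a < top"
  by (simp add: enn_powr_def less_top)

text \<open>On the sphere \<open>\<Omega>\<close> is measurable only for the completed measure. A
  Borel version there is extended along rays by composing with \<open>sgn\<close>, which makes
  homogeneity hold at every point, the origin included. Agreement almost everywhere in space holds
  because cones over null sets are null. The last two conclusions are the forms in which the
  \<open>L^s\<close> hypothesis is used later.\<close>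

lemma homogeneous_borel_representative:
  fixes \<Omega> :: "'a::euclidean_space \<Rightarrow> complex"
  assumes hom: "homogeneous_degree_zero \<Omega>" and L: "\<Omega> \<in> Lp_space sphere_measure s" and s: "s > 0"
  obtains \<Theta> :: "'a \<Rightarrow> complex" where "\<Theta> \<in> borel_measurable borel"
    "\<forall>t>0. \<forall>x. \<Theta> (t *\<^sub>R x) = \<Theta> x" "AE x in lborel. \<Omega> x = \<Theta> x"
    "s = top \<Longrightarrow> \<exists>M. \<forall>x. norm (\<Theta> x) \<le> M"
    "s < top \<Longrightarrow> (\<integral>\<^sup>+x. ennreal (norm (\<Theta> x) powr enn2real s) * indicator (ball 0 1) x \<partial>lborel) < top"
proof -
  define S where "S = sphere (0::'a) 1"
  define R where "R = (restrict_space lborel (ball 0 1 - {0}) :: 'a measure)"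
  define c where "c = 1 / emeasure lborel (ball (0::'a) 1)"
  define M where "M = scale_measure c (distr R (restrict_space borel S) sgn)"
  have sm: "sphere_measure = completion M"
    by (simp add: sphere_measure_def M_def R_def S_def c_def)
  \<comment> \<open>The finite volume of the ball makes the normalising factor nonzero, so
    finiteness on the sphere can be carried back to the ball at the end.\<close>
  have c: "c > 0"
    using emeasure_lborel_ball_finite[of "0::'a" 1] by (simp add: c_def ennreal_zero_less_divide)
  have S: "S \<in> sets borel" by (simp add: S_def)
  have sets_M: "sets M = sets (restrict_space borel S)" by (simp add: M_def)
  have space_M: "space M = S" by (simp add: M_def space_scale_measure space_restrict_space)
  have sgn [measurable]: "(sgn :: 'a \<Rightarrow> 'a) \<in> borel_measurable borel"
    unfolding sgn_div_norm by measurable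
  have "\<Omega> \<in> borel_measurable (completion M)" using L by (simp add: Lp_space_def sm)
  then obtain g where g: "g \<in> borel_measurable M" "AE x in M. \<Omega> x = g x"
    by (rule exists_borel_representative)
  obtain m where m: "s = top \<Longrightarrow> AE x in M. norm (g x) \<le> m"
  proof (cases "s = top")
    case True
    have fin: "esssup (completion M) (\<lambda>x. ennreal (norm (\<Omega> x))) < top"
      using L True by (simp add: Lp_space_def Lp_norm_def sm)
    then obtain m where m: "m \<ge> 0" "esssup (completion M) (\<lambda>x. ennreal (norm (\<Omega> x))) = ennreal m"
      by (metis less_top_ennreal)
    have "AE x in completion M. ennreal (norm (\<Omega> x)) \<le> ennreal m"
      using esssup_AE[of "\<lambda>x. ennreal (norm (\<Omega> x))" "completion M"] by (simp add: m)
    then have "AE x in M. ennreal (norm (\<Omega> x)) \<le> ennreal m"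
      by (simp add: AE_completion_iff)
    with g(2) have "AE x in M. norm (g x) \<le> m"
      by eventually_elim (use m(1) in auto)
    then show ?thesis by (rule that)
  next
    case False
    then show ?thesis by (intro that[of 0]) simp
  qed
  define G where "G x = indicator S x *\<^sub>R g x" for x
  \<comment> \<open>Values beyond the essential bound occur only on a null set; erasing them gives a
    bound at every point, as used in the case \<open>p = 1\<close>.\<close>
  define G' where "G' x = (if s = top \<and> norm (G x) > m then 0 else G x)" for x
  have "g \<in> borel_measurable (restrict_space borel S)"
    using g(1) by (simp cong: measurable_cong_sets add: sets_M)
  then have [measurable]: "G \<in> borel_measurable borel"
    using S by (subst (asm) borel_measurable_restrict_space_iff) (auto simp: G_def[abs_def])
  have [measurable]: "G' \<in> borel_measurable borel"
    unfolding G'_def[abs_def] by measurable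
  have AEG: "AE x in M. \<Omega> x = G' x"
  proof (cases "s = top")
    case True
    show ?thesis
      using g(2) m[OF True] AE_space
      by eventually_elim (auto simp: G'_def G_def space_M)
  next
    case False
    show ?thesis
      using g(2) AE_space
      by eventually_elim (auto simp: G'_def G_def space_M False)
  qed
  define \<Theta> where "\<Theta> x = G' (sgn x)" for x
  show ?thesis
  proof (rule that[of \<Theta>])
    show \<Theta>: "\<Theta> \<in> borel_measurable borel" unfolding \<Theta>_def[abs_def] by measurable
    show "\<forall>t>0. \<forall>x. \<Theta> (t *\<^sub>R x) = \<Theta> x" by (simp add: \<Theta>_def sgn_scaleR)
    \<comment> \<open>Nothing is recorded about the sign of \<open>m\<close>, and the erased values
      are 0, hence the maximum.\<close>
    show "\<exists>M. \<forall>x. norm (\<Theta> x) \<le> M" if "s = top"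
      by (rule exI[of _ "max m 0"]) (auto simp: \<Theta>_def G'_def that)
    from AEG obtain N where N: "{x \<in> space M. \<Omega> x \<noteq> G' x} \<subseteq> N" "emeasure M N = 0" "N \<in> sets M"
      by (rule AE_E)
    have N': "N \<in> sets borel" "N \<subseteq> sphere 0 1"
      using N(3) S by (auto simp: sets_M sets_restrict_space S_def)
    have "AE x in lborel. sgn x \<notin> N"
      using N by (intro AE_sgn_notin_sphere_null N') (simp add: sm)
    \<comment> \<open>The origin is discarded: its \<open>sgn\<close> is not on the sphere, and
      homogeneity says nothing about \<open>\<Omega>\<close> there.\<close>
    then show "AE x in lborel. \<Omega> x = \<Theta> x"
      using AE_lborel_singleton[of 0]
    proof eventually_elim
      case (elim x)
      have "sgn x \<in> space M" using elim by (simp add: space_M S_def norm_sgn)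
      then have "\<Omega> (sgn x) = G' (sgn x)" using elim N(1) by blast
      moreover have "\<Omega> (sgn x) = \<Omega> x"
        using hom elim(2) by (simp add: homogeneous_degree_zero_def sgn_div_norm)
      ultimately show ?case by (simp add: \<Theta>_def)
    qed
    show "(\<integral>\<^sup>+x. ennreal (norm (\<Theta> x) powr enn2real s) * indicator (ball 0 1) x \<partial>lborel) < top" if st: "s < top"
    proof -
      define P where "P z = ennreal (norm z powr enn2real s)" for z :: complex
      have [measurable]: "P \<in> borel_measurable borel" unfolding P_def[abs_def] by measurable
      have sgnR: "sgn \<in> R \<rightarrow>\<^sub>M restrict_space borel S"
        unfolding R_def S_def by (rule sgn_measurable_sphere)
      have PG: "(\<lambda>x. P (G' x)) \<in> borel_measurable (restrict_space borel S)"
        by (intro measurable_restrict_space1) measurable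
      have "(\<integral>\<^sup>+x. P (\<Omega> x) \<partial>completion M) < top"
        using L less_imp_neq[OF st] by (simp add: Lp_space_def Lp_norm_def sm P_def enn_powr_less_top_iff)
      also have "(\<integral>\<^sup>+x. P (\<Omega> x) \<partial>completion M) = (\<integral>\<^sup>+x. P (G' x) \<partial>M)"
        unfolding nn_integral_completion
        by (rule nn_integral_cong_AE) (use AEG in \<open>eventually_elim; simp\<close>)
      also have "\<dots> = c * (\<integral>\<^sup>+x. P (G' (sgn x)) \<partial>R)"
        using PG sgnR by (simp add: M_def nn_integral_scale_measure nn_integral_distr)
      also have "(\<integral>\<^sup>+x. P (G' (sgn x)) \<partial>R) = (\<integral>\<^sup>+x. P (\<Theta> x) * indicator (ball 0 1 - {0}) x \<partial>lborel)"
        unfolding R_def \<Theta>_def by (rule nn_integral_restrict_space) simp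
      also have "\<dots> = (\<integral>\<^sup>+x. P (\<Theta> x) * indicator (ball 0 1) x \<partial>lborel)"
        using AE_lborel_singleton[of 0]
        by (intro nn_integral_cong_AE, eventually_elim) (auto simp: indicator_def)
      finally show ?thesis
        using c by (auto simp: P_def ennreal_mult_less_top)
    qed
  qed
qed

section \<open>Uniform bound for the far kernel\<close>

text \<open>Hoelder's inequality against the far kernel. For \<open>p = 1\<close> the kernel is at
  most a constant times \<open>r powr (\<alpha> - DIM('a))\<close>. For \<open>p > 1\<close> its
  power \<open>p'\<close> decays with exponent \<open>(\<alpha> - n) * p'\<close>, which lies below
  \<open>- n\<close> because \<open>q > 0\<close>. The universal quantifier over \<open>u\<close>
  after \<open>B\<close> records uniformity over the unit ball of \<open>L^p\<close>.\<close>

lemma nn_convolution_far_le: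
  fixes W :: "'a::euclidean_space \<Rightarrow> real" and \<alpha> p q :: real
  assumes W [measurable]: "W \<in> borel_measurable borel" and hom: "\<forall>t>0. \<forall>x. W (t *\<^sub>R x) = W x"
    and W0: "\<And>x. W x \<ge> 0"
    and int: "p = 1 \<and> (\<exists>M. \<forall>x. W x \<le> M) \<or>
       p > 1 \<and> (\<integral>\<^sup>+x. ennreal (W x powr (p / (p - 1))) * indicator (ball 0 1) x \<partial>lborel) < top"
    and q: "q > 0" and pq: "1 / q = 1 / p - \<alpha> / DIM('a)"
  obtains B where "B > 0"
    "\<forall>u. u \<in> borel_measurable borel \<and> (\<forall>x. u x \<ge> 0) \<and> (\<integral>\<^sup>+x. ennreal (u x powr p) \<partial>lborel) \<le> 1 \<longrightarrow>
      (\<forall>r x. r > 0 \<longrightarrow>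
       (\<integral>\<^sup>+y. ennreal (W (x - y) * norm (x - y) powr (\<alpha> - DIM('a))) * ennreal (u y) *
          indicator (- ball 0 r) (x - y) \<partial>lborel) \<le> ennreal (B * r powr (- real DIM('a) / q)))"
proof (cases "p = 1")
  case True
  with int obtain M where M: "\<And>x. W x \<le> M" by auto
  have M0: "M \<ge> 0" using M[of 0] W0[of 0] by simp
  have exp: "- real DIM('a) / q = \<alpha> - DIM('a)"
    using pq q True by (simp add: field_simps)
  then have exp_neg: "\<alpha> - DIM('a) \<le> 0"
    using q by (metis divide_nonneg_pos minus_divide_left neg_le_0_iff_le of_nat_0_le_iff)
  show ?thesis
  proof (rule that[of "M + 1"]; (intro allI impI)?; (elim conjE)?)
    fix u :: "'a \<Rightarrow> real" and r :: real and x :: 'a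
    assume [measurable]: "u \<in> borel_measurable borel" and u0: "\<forall>x. u x \<ge> 0"
      and u1: "(\<integral>\<^sup>+x. ennreal (u x powr p) \<partial>lborel) \<le> 1" and r: "r > 0"
    have "(\<integral>\<^sup>+y. ennreal (W (x - y) * norm (x - y) powr (\<alpha> - DIM('a))) * ennreal (u y) *
          indicator (- ball 0 r) (x - y) \<partial>lborel)
        \<le> (\<integral>\<^sup>+y. ennreal (M * r powr (\<alpha> - DIM('a))) * ennreal (u y powr p) \<partial>lborel)"
    proof (rule nn_integral_mono)
      fix y
      show "ennreal (W (x - y) * norm (x - y) powr (\<alpha> - DIM('a))) * ennreal (u y) *
          indicator (- ball 0 r) (x - y) \<le> ennreal (M * r powr (\<alpha> - DIM('a))) * ennreal (u y powr p)"
      proof (cases "norm (x - y) < r")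
        case False
        then have "W (x - y) * norm (x - y) powr (\<alpha> - DIM('a)) \<le> M * r powr (\<alpha> - DIM('a))"
          using M M0 r exp_neg by (intro mult_mono powr_mono2') auto
        then show ?thesis
          using False u0 True by (auto intro!: mult_right_mono ennreal_leI)
      qed simp
    qed
    also have "\<dots> = ennreal (M * r powr (\<alpha> - DIM('a))) * (\<integral>\<^sup>+y. ennreal (u y powr p) \<partial>lborel)"
      by (rule nn_integral_cmult) measurable
    also have "\<dots> \<le> ennreal (M * r powr (\<alpha> - DIM('a)))"
      using mult_left_mono[OF u1, of "ennreal (M * r powr (\<alpha> - DIM('a)))"] by simp
    also have "\<dots> \<le> ennreal ((M + 1) * r powr (- real DIM('a) / q))"
      unfolding exp by (intro ennreal_leI mult_right_mono) auto
    finally show "(\<integral>\<^sup>+y. ennreal (W (x - y) * norm (x - y) powr (\<alpha> - DIM('a))) * ennreal (u y) *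
          indicator (- ball 0 r) (x - y) \<partial>lborel) \<le> ennreal ((M + 1) * r powr (- real DIM('a) / q))" .
  qed (use M0 in simp)
next
  case False
  with int have p: "p > 1" and
    J: "(\<integral>\<^sup>+x. ennreal (W x powr (p / (p - 1))) * indicator (ball 0 1) x \<partial>lborel) < top" by auto
  define p' where "p' = p / (p - 1)"
  define n where "n = real DIM('a)"
  have n: "n > 0" by (simp add: n_def)
  have p': "p' > 1" "1 / p' + 1 / p = 1" using p by (auto simp: p'_def field_simps)
  \<comment> \<open>Since \<open>(n - n / p) * p' = n\<close>, the summand \<open>n\<close> can be
    drawn into the product, leaving the factor \<open>\<alpha> - n / p\<close>, which is
    \<open>- n / q\<close>.\<close>
  have exp: "(\<alpha> - n) * p' + n = (- n / q) * p'"
  proof -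
    have "n / q = n / p - \<alpha>"
      using pq n p q by (simp add: n_def[symmetric] field_simps)
    moreover have "(n - n / p) * p' = n"
      using p by (simp add: p'_def field_simps)
    then have "(\<alpha> - n) * p' + n = (\<alpha> - n / p) * p'"
      by (simp only: left_diff_distrib)
    ultimately show ?thesis by simp
  qed
  have W': "(\<lambda>x. ennreal (W x powr p')) \<in> borel_measurable borel" by measurable
  have hom': "\<forall>t>0. \<forall>x. ennreal (W (t *\<^sub>R x) powr p') = ennreal (W x powr p')" using hom by simp
  have neg: "(\<alpha> - n) * p' + real DIM('a) < 0"
    using exp n q p' by (simp add: n_def)
  obtain E where E: "E > 0" "\<And>r. r > 0 \<Longrightarrow>
     (\<integral>\<^sup>+x. ennreal (W x powr p') * ennreal (norm x powr ((\<alpha> - n) * p')) * indicator (- ball 0 r) x \<partial>lborel)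
        \<le> ennreal (E * r powr ((\<alpha> - n) * p' + DIM('a)))"
    using nn_integral_homogeneous_far[OF W' hom' J[folded p'_def] neg] by blast
  show ?thesis
  \<comment> \<open>In Young's inequality \<open>E\<close> comes from the kernel and 1 from the
    normalised \<open>u\<close>.\<close>
  proof (rule that[of "E + 1"]; (intro allI impI)?; (elim conjE)?)
    fix u :: "'a \<Rightarrow> real" and r :: real and x :: 'a
    assume [measurable]: "u \<in> borel_measurable borel" and u0: "\<forall>x. u x \<ge> 0"
      and u1: "(\<integral>\<^sup>+x. ennreal (u x powr p) \<partial>lborel) \<le> 1" and r: "r > 0"
    \<comment> \<open>The order of the \<open>L^p'\<close> norm of the far kernel; dividing by it
      before Young's inequality makes both terms bounded independently of \<open>r\<close>, so the
      sum has the same size as the Hoelder product.\<close>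
    define m where "m = r powr (- n / q)"
    have m: "m > 0" using r by (simp add: m_def)
    define H where "H z = ennreal (W z powr p') * ennreal (norm z powr ((\<alpha> - n) * p')) * indicator (- ball 0 r) z" for z
    have [measurable]: "(\<lambda>x. indicator (- ball 0 r) x :: ennreal) \<in> borel_measurable (borel :: 'a measure)"
      by (intro borel_measurable_indicator) simp
    have H [measurable]: "H \<in> borel_measurable borel" unfolding H_def[abs_def] by measurable
    have "(\<integral>\<^sup>+y. ennreal (W (x - y) * norm (x - y) powr (\<alpha> - n)) * ennreal (u y) *
          indicator (- ball 0 r) (x - y) \<partial>lborel)
       \<le> (\<integral>\<^sup>+y. ennreal m * (ennreal (m powr (- p')) * H (x - y) + ennreal (u y powr p)) \<partial>lborel)"
    proof (rule nn_integral_mono)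
      fix y
      define k where "k = W (x - y) * norm (x - y) powr (\<alpha> - n)"
      have k: "k \<ge> 0" using W0 by (simp add: k_def)
      show "ennreal (W (x - y) * norm (x - y) powr (\<alpha> - n)) * ennreal (u y) *
          indicator (- ball 0 r) (x - y) \<le> ennreal m * (ennreal (m powr (- p')) * H (x - y) + ennreal (u y powr p))"
      proof (cases "norm (x - y) < r")
        case False
        have "(k / m) * u y \<le> (k / m) powr p' / p' + u y powr p / p"
          using p p' k m u0 by (intro Youngs_inequality) auto
        \<comment> \<open>The weights \<open>1 / p'\<close> and \<open>1 / p\<close> affect only the
          constant and are replaced by 1.\<close>
        also have "\<dots> \<le> (k / m) powr p' / 1 + u y powr p / 1"
          using p p' by (intro add_mono divide_left_mono) auto
        finally have "k * u y \<le> m * (m powr (- p') * k powr p' + u y powr p)"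
          using m k by (simp add: powr_divide powr_minus_divide field_simps)
        moreover have "k powr p' = W (x - y) powr p' * norm (x - y) powr ((\<alpha> - n) * p')"
          using W0 by (simp add: k_def powr_mult powr_powr)
        ultimately have "k * u y \<le> m * (m powr (- p') * (W (x - y) powr p' * norm (x - y) powr ((\<alpha> - n) * p')) + u y powr p)"
          by simp
        then have "ennreal (k * u y) \<le> ennreal m * (ennreal (m powr (- p')) *
            (ennreal (W (x - y) powr p') * ennreal (norm (x - y) powr ((\<alpha> - n) * p'))) + ennreal (u y powr p))"
          using m by (simp add: ennreal_mult[symmetric] ennreal_plus[symmetric] ennreal_leI del: ennreal_plus)
        then show ?thesis
          using False k u0 by (simp add: H_def k_def[symmetric] ennreal_mult)
      qed simp
    qed
    also have "\<dots> = ennreal m * (ennreal (m powr (- p')) * (\<integral>\<^sup>+y. H y \<partial>lborel) + (\<integral>\<^sup>+y. ennreal (u y powr p) \<partial>lborel))"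
      using nn_integral_lborel_reflect[OF H, of x] by (simp add: nn_integral_cmult nn_integral_add)
    also have "\<dots> \<le> ennreal m * (ennreal (m powr (- p')) * ennreal (E * r powr ((- n / q) * p')) + 1)"
      using E(2)[OF r] u1 by (intro mult_left_mono add_mono) (auto simp: H_def exp n_def[symmetric])
    also have "ennreal (m powr (- p')) * ennreal (E * r powr ((- n / q) * p')) = ennreal E"
    proof -
      have "m powr (- p') * r powr ((- n / q) * p') = 1"
        using r unfolding m_def powr_powr by (simp add: powr_add[symmetric])
      then show ?thesis using E(1) by (simp add: ennreal_mult[symmetric])
    qed
    also have "ennreal m * (ennreal E + 1) = ennreal ((E + 1) * m)"
      using E(1) m by (simp add: ennreal_1[symmetric] ennreal_plus[symmetric] ennreal_mult[symmetric] mult.commute del: ennreal_plus ennreal_1)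
    finally show "(\<integral>\<^sup>+y. ennreal (W (x - y) * norm (x - y) powr (\<alpha> - DIM('a))) * ennreal (u y) *
          indicator (- ball 0 r) (x - y) \<partial>lborel) \<le> ennreal ((E + 1) * r powr (- real DIM('a) / q))"
      by (simp add: m_def n_def)
  qed (use E in simp)
qed

section \<open>Norms in the extended reals and removal of the normalisation\<close>

lemma nn_convolution_scale:
  fixes K :: "'a::euclidean_space \<Rightarrow> ennreal" and c :: real
  assumes [measurable]: "K \<in> borel_measurable borel" "u \<in> borel_measurable borel" and "c \<ge> 0"
  shows "nn_convolution K (\<lambda>y. c * u y) x = ennreal c * nn_convolution K u x"
  unfolding nn_convolution_def using \<open>c \<ge> 0\<close>
  by (simp add: nn_integral_cmult[symmetric] ennreal_mult' mult_ac)

text \<open>Lets a bound \<open>a\<close> for the norm decrease to the norm \<open>b\<close> itself;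
  the strict inequality keeps the scaling factor positive when the norm is 0.\<close>

lemma ennreal_le_cmult_of_gt:
  fixes x :: ennreal and c b :: real
  assumes "\<And>a. a > b \<Longrightarrow> x \<le> ennreal (c * a)" and c: "c > 0" and b: "b \<ge> 0"
  shows "x \<le> ennreal (c * b)"
proof (rule ennreal_le_epsilon)
  fix e :: real assume "e > 0"
  then have "x \<le> ennreal (c * (b + e / c))" using c by (intro assms(1)) simp
  also have "\<dots> = ennreal (c * b) + ennreal e" using b c \<open>e > 0\<close> by (simp add: distrib_left)
  finally show "x \<le> ennreal (c * b) + ennreal e" .
qed

lemma enn_powr_le:
  assumes "x \<le> ennreal (b powr q)" "q > 0" "b \<ge> 0"
  shows "enn_powr x (1 / q) \<le> ennreal b"
proof -
  have "x \<noteq> top" using assms(1) by (auto simp: top_unique)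
  then obtain r where r: "x = ennreal r" "r \<ge> 0" by (cases x) auto
  then have "r powr (1 / q) \<le> (b powr q) powr (1 / q)"
    using assms by (intro powr_mono2) auto
  then show ?thesis using r assms by (simp add: enn_powr_def powr_powr ennreal_leI)
qed

lemma Lp_norm_ennreal:
  assumes "p > 0"
  shows "Lp_norm M (ennreal p) f = enn_powr (\<integral>\<^sup>+x. ennreal (norm (f x) powr p) \<partial>M) (1 / p)"
  using assms by (simp add: Lp_norm_def)

lemma nn_integral_powr_of_Lp_norm:
  assumes f: "Lp_norm M (ennreal p) f < top" and p: "p > 0"
  obtains b where "b \<ge> 0" "Lp_norm M (ennreal p) f = ennreal b"
    "(\<integral>\<^sup>+x. ennreal (norm (f x) powr p) \<partial>M) = ennreal (b powr p)"
proof -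
  have "(\<integral>\<^sup>+x. ennreal (norm (f x) powr p) \<partial>M) < top"
    using f p by (simp add: Lp_norm_ennreal enn_powr_less_top_iff)
  then obtain r where r: "r \<ge> 0" "(\<integral>\<^sup>+x. ennreal (norm (f x) powr p) \<partial>M) = ennreal r"
    by (metis less_top_ennreal)
  show ?thesis
    by (rule that[of "r powr (1 / p)"]) (use r p in \<open>auto simp: Lp_norm_ennreal enn_powr_def powr_powr\<close>)
qed

text \<open>Dividing by \<open>F\<close> reduces to the normalised case, and linearity of the
  convolution restores the size. \<open>F\<close> is any positive bound for the norm, so that the
  division makes sense for \<open>u = 0\<close> as well. One \<open>C\<close> serves both
  conclusions.\<close>

lemma nn_convolution_bounds:
  fixes W :: "'a::euclidean_space \<Rightarrow> real" and \<alpha> p q :: real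
  defines "K \<equiv> \<lambda>z. ennreal (W z * norm z powr (\<alpha> - DIM('a)))"
  assumes W [measurable]: "W \<in> borel_measurable borel" and hom: "\<forall>t>0. \<forall>x. W (t *\<^sub>R x) = W x"
    and W0: "\<And>x. W x \<ge> 0"
    and int1: "(\<integral>\<^sup>+x. ennreal (W x) * indicator (ball 0 1) x \<partial>lborel) < top"
    and int: "p = 1 \<and> (\<exists>M. \<forall>x. W x \<le> M) \<or>
       p > 1 \<and> (\<integral>\<^sup>+x. ennreal (W x powr (p / (p - 1))) * indicator (ball 0 1) x \<partial>lborel) < top"
    and \<alpha>: "\<alpha> > 0" and p: "p \<ge> 1" and q: "q > 0" and pq: "1 / q = 1 / p - \<alpha> / DIM('a)"
  obtains C where "C > 0"
    "\<forall>u F v. u \<in> borel_measurable borel \<and> (\<forall>x. u x \<ge> 0) \<and> F > 0 \<and>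
       (\<integral>\<^sup>+x. ennreal (u x powr p) \<partial>lborel) \<le> ennreal (F powr p) \<longrightarrow>
       (\<forall>l>0. emeasure lborel {x. ennreal l < nn_convolution K u x} \<le> ennreal ((C * F / l) powr q)) \<and>
       (p > 1 \<and> v \<in> borel_measurable borel \<and> (\<forall>x. v x \<ge> 0 \<and> ennreal (v x) \<le> nn_convolution K u x) \<longrightarrow>
          (\<integral>\<^sup>+x. ennreal (v x powr q) \<partial>lborel) \<le> ennreal ((C * F) powr q))"
proof -
  have K [measurable]: "K \<in> borel_measurable borel" unfolding K_def by measurable
  have W': "(\<lambda>x. ennreal (W x)) \<in> borel_measurable borel" by measurable
  have hom': "\<forall>t>0. \<forall>x. ennreal (W (t *\<^sub>R x)) = ennreal (W x)" using hom by simp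
  have pos: "\<alpha> - DIM('a) + DIM('a) > 0" using \<alpha> by simp
  obtain A where A: "A > 0" "\<And>r. r > 0 \<Longrightarrow>
     (\<integral>\<^sup>+x. ennreal (W x) * ennreal (norm x powr (\<alpha> - DIM('a))) * indicator (ball 0 r) x \<partial>lborel)
        \<le> ennreal (A * r powr (\<alpha> - DIM('a) + DIM('a)))"
    using nn_integral_homogeneous_near[OF W' hom' int1 pos] by blast
  have near: "(\<integral>\<^sup>+x. K x * indicator (ball 0 r) x \<partial>lborel) \<le> ennreal (A * r powr \<alpha>)" if "r > 0" for r
    using A(2)[OF that] W0 by (simp add: K_def ennreal_mult)
  obtain B where B: "B > 0" and far:
    "\<forall>u. u \<in> borel_measurable borel \<and> (\<forall>x. u x \<ge> 0) \<and> (\<integral>\<^sup>+x. ennreal (u x powr p) \<partial>lborel) \<le> 1 \<longrightarrow>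
      (\<forall>r x. r > 0 \<longrightarrow>
       (\<integral>\<^sup>+y. ennreal (W (x - y) * norm (x - y) powr (\<alpha> - DIM('a))) * ennreal (u y) *
          indicator (- ball 0 r) (x - y) \<partial>lborel) \<le> ennreal (B * r powr (- real DIM('a) / q)))"
    using nn_convolution_far_le[OF W hom W0 int q pq] by blast
  define D where "D = 1 / (A * B powr (q * \<alpha> / DIM('a)))"
  have D: "D > 0" using A(1) B by (simp add: D_def)
  have le: "emeasure lborel {x. ennreal (3 * l) < nn_convolution K u x}
     \<le> ennreal (1 / (D * l powr (q / p))) *
        (\<integral>\<^sup>+y. ennreal (u y) * indicator {D * l powr (q / p)<..} (u y) \<partial>lborel)"
    if u: "u \<in> borel_measurable borel" "\<forall>x. u x \<ge> 0" "(\<integral>\<^sup>+x. ennreal (u x powr p) \<partial>lborel) \<le> 1"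
      and l: "l > 0" for u l
  proof (rule emeasure_fractional_convolution_le[OF K u(1) near _ A(1) B _ q _ pq l D_def])
    fix r :: real and x :: 'a assume "r > 0"
    then show "(\<integral>\<^sup>+y. K (x - y) * ennreal (u y) * indicator (- ball 0 r) (x - y) \<partial>lborel)
        \<le> ennreal (B * r powr (- real DIM('a) / q))"
      using far u unfolding K_def by blast
  qed (use p in auto)
  define C1 where "C1 = D powr (- p) * 3 powr q"
  \<comment> \<open>For \<open>p = 1\<close> the denominator is 0, so \<open>C2 = 0\<close> by
    convention and the maximum below is \<open>C1\<close>; the strong bound uses \<open>C2\<close>
    only for \<open>p > 1\<close>.\<close>
  define C2 where "C2 = 3 powr q * q / (D powr p * (q - q / p))"
  define C where "C = (max C1 C2) powr (1 / q)"
  have C1: "C1 > 0" using D by (simp add: C1_def)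
  have C: "C > 0" using C1 by (simp add: C_def max_def)
  have Cq: "C powr q = max C1 C2" using C1 q by (simp add: C_def powr_powr)
  show ?thesis
  proof (rule that[OF C]; intro allI impI; elim conjE)
    fix u v :: "'a \<Rightarrow> real" and F :: real
    assume u [measurable]: "u \<in> borel_measurable borel" and u0: "\<forall>x. u x \<ge> 0" and F: "F > 0"
      and uF: "(\<integral>\<^sup>+x. ennreal (u x powr p) \<partial>lborel) \<le> ennreal (F powr p)"
    define w where "w x = u x / F" for x
    have w [measurable]: "w \<in> borel_measurable borel" unfolding w_def[abs_def] by measurable
    have w0: "\<forall>x. w x \<ge> 0" using u0 F by (simp add: w_def)
    have w1: "(\<integral>\<^sup>+x. ennreal (w x powr p) \<partial>lborel) \<le> 1"
    proof -
      have "(\<integral>\<^sup>+x. ennreal (w x powr p) \<partial>lborel) = (\<integral>\<^sup>+x. ennreal (F powr (- p)) * ennreal (u x powr p) \<partial>lborel)"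
        using u0 F by (intro nn_integral_cong) (simp add: w_def powr_divide powr_minus_divide ennreal_mult[symmetric])
      also have "\<dots> \<le> ennreal (F powr (- p)) * ennreal (F powr p)"
        using uF by (simp add: nn_integral_cmult mult_left_mono)
      also have "\<dots> = 1"
        using F by (simp add: ennreal_mult[symmetric] powr_minus)
      finally show ?thesis .
    qed
    have uw: "nn_convolution K u x = ennreal F * nn_convolution K w x" for x
      using nn_convolution_scale[OF K w, of F x] F by (simp add: w_def)
    show "(\<forall>l>0. emeasure lborel {x. ennreal l < nn_convolution K u x} \<le> ennreal ((C * F / l) powr q)) \<and>
       (p > 1 \<and> v \<in> borel_measurable borel \<and> (\<forall>x. v x \<ge> 0 \<and> ennreal (v x) \<le> nn_convolution K u x) \<longrightarrow>
          (\<integral>\<^sup>+x. ennreal (v x powr q) \<partial>lborel) \<le> ennreal ((C * F) powr q))"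
    proof (intro conjI allI impI; (elim conjE)?)
      fix l :: real assume l: "l > 0"
      have "ennreal l < nn_convolution K u x \<longleftrightarrow> ennreal (l / F) < nn_convolution K w x" for x
      proof -
        have "ennreal l = ennreal F * ennreal (l / F)" using l F by (simp add: ennreal_mult[symmetric])
        then show ?thesis using F by (simp add: uw not_le[symmetric] ennreal_mult_le_mult_iff)
      qed
      then have "emeasure lborel {x. ennreal l < nn_convolution K u x}
          = emeasure lborel {x. ennreal (l / F) < nn_convolution K w x}" by simp
      also have "\<dots> \<le> ennreal (C1 * (l / F) powr (- q))"
        using weak_type_nn_convolution[OF w _ le[OF w w0 w1] D p q w1, of "l / F"] w0 l F
        by (simp add: C1_def)
      also have "\<dots> \<le> ennreal ((C * F / l) powr q)"
      proof (rule ennreal_leI)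
        have "C1 * (l / F) powr (- q) \<le> C powr q * (l / F) powr (- q)"
          by (intro mult_right_mono) (auto simp: Cq)
        also have "\<dots> = (C * F / l) powr q"
          using C F l by (simp add: powr_mult powr_divide powr_minus_divide)
        finally show "C1 * (l / F) powr (- q) \<le> (C * F / l) powr q" .
      qed
      finally show "emeasure lborel {x. ennreal l < nn_convolution K u x} \<le> ennreal ((C * F / l) powr q)" .
    next
      assume p1: "p > 1" and v [measurable]: "v \<in> borel_measurable borel"
        and v0: "\<forall>x. v x \<ge> 0 \<and> ennreal (v x) \<le> nn_convolution K u x"
      define v' where "v' x = v x / F" for x
      have v' [measurable]: "v' \<in> borel_measurable borel" unfolding v'_def[abs_def] by measurable
      have "ennreal (v' x) \<le> nn_convolution K w x" for x
      proof -
        have "ennreal F * ennreal (v' x) \<le> ennreal F * nn_convolution K w x"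
          using v0 F by (simp add: v'_def ennreal_mult[symmetric] uw[symmetric])
        then show ?thesis using F by (simp add: ennreal_mult_le_mult_iff)
      qed
      moreover have "v' x \<ge> 0" for x using v0 F by (simp add: v'_def)
      ultimately have *: "(\<integral>\<^sup>+x. ennreal (v' x powr q) \<partial>lborel) \<le> ennreal C2"
        unfolding C2_def using w0
        by (intro strong_type_nn_convolution[OF w _ v' _ K _ le[OF w w0 w1] D p1 q w1]) auto
      have "(\<integral>\<^sup>+x. ennreal (v x powr q) \<partial>lborel) = (\<integral>\<^sup>+x. ennreal (F powr q) * ennreal (v' x powr q) \<partial>lborel)"
        using v0 F by (intro nn_integral_cong) (simp add: v'_def powr_divide ennreal_mult[symmetric])
      also have "\<dots> = ennreal (F powr q) * (\<integral>\<^sup>+x. ennreal (v' x powr q) \<partial>lborel)"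
        by (simp add: nn_integral_cmult)
      also have "\<dots> \<le> ennreal (F powr q) * ennreal (C powr q)"
        by (intro mult_left_mono order.trans[OF *] ennreal_leI) (auto simp: Cq)
      also have "\<dots> = ennreal ((C * F) powr q)"
        using C F by (simp add: powr_mult ennreal_mult[symmetric] mult.commute)
      finally show "(\<integral>\<^sup>+x. ennreal (v x powr q) \<partial>lborel) \<le> ennreal ((C * F) powr q)" .
    qed
  qed
qed

section \<open>From convolutions to the fractional integral operator\<close>

lemma AE_lborel_reflect:
  fixes x :: "'a::euclidean_space"
  assumes "AE z in lborel. P z"
  shows "AE y in lborel. P (x - y)"
proof -
  obtain N where N: "{z. \<not> P z} \<subseteq> N" "emeasure lborel N = 0" "N \<in> sets borel"
    using assms by (auto elim!: AE_E)
  have [measurable]: "N \<in> sets borel" by fact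
  have "(\<integral>\<^sup>+y. indicator N (x - y) \<partial>lborel) = 0"
    using nn_integral_lborel_reflect[of "indicator N" x] N by simp
  then have "AE y in lborel. indicator N (x - y) = (0::ennreal)"
    by (subst (asm) nn_integral_0_iff_AE) auto
  then show ?thesis
    by eventually_elim (use N(1) in \<open>auto simp: indicator_def split: if_splits\<close>)
qed

text \<open>Reflection preserves null sets, so at each single \<open>x\<close> the two integrands
  agree for almost every \<open>y\<close>. Passing to representatives therefore leaves the operator
  unchanged at every point, and points of divergence share the default value 0.\<close>

lemma frac_integral_representative:
  fixes \<Omega> \<Theta> f g :: "real^'n \<Rightarrow> complex"
  assumes [measurable]: "\<Theta> \<in> borel_measurable borel" "g \<in> borel_measurable borel"
    and "AE x in lborel. \<Omega> x = \<Theta> x" "AE x in lborel. f x = g x"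
  shows "integrable lebesgue (frac_integrand \<Omega> \<alpha> f x) \<longleftrightarrow> integrable lborel (frac_integrand \<Theta> \<alpha> g x)"
    and "frac_integral \<Omega> \<alpha> f x = (\<integral>y. frac_integrand \<Theta> \<alpha> g x y \<partial>lborel)"
proof -
  have m: "frac_integrand \<Theta> \<alpha> g x \<in> borel_measurable lborel"
    unfolding frac_integrand_def[abs_def] by measurable
  have "AE y in lborel. frac_integrand \<Theta> \<alpha> g x y = frac_integrand \<Omega> \<alpha> f x y"
    using AE_lborel_reflect[OF assms(3), of x] assms(4)
    by eventually_elim (simp add: frac_integrand_def)
  then have ae: "AE y in lebesgue. frac_integrand \<Theta> \<alpha> g x y = frac_integrand \<Omega> \<alpha> f x y"
    by (rule AE_completion)
  have m1: "frac_integrand \<Theta> \<alpha> g x \<in> borel_measurable lebesgue"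
    using m by (rule measurable_completion)
  have m2: "frac_integrand \<Omega> \<alpha> f x \<in> borel_measurable lebesgue"
    using m1 ae by (rule borel_measurable_AE)
  show "integrable lebesgue (frac_integrand \<Omega> \<alpha> f x) \<longleftrightarrow> integrable lborel (frac_integrand \<Theta> \<alpha> g x)"
    using integrable_cong_AE[OF m1 m2 ae] integrable_completion[OF m] by simp
  show "frac_integral \<Omega> \<alpha> f x = (\<integral>y. frac_integrand \<Theta> \<alpha> g x y \<partial>lborel)"
    using integral_cong_AE[OF m1 m2 ae] integral_completion[OF m] by (simp add: frac_integral_def)
qed

lemma nn_integral_norm_frac_integrand:
  fixes \<Theta> g :: "real^'n \<Rightarrow> complex"
  shows "(\<integral>\<^sup>+y. ennreal (norm (frac_integrand \<Theta> \<alpha> g x y)) \<partial>lborel)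
    = nn_convolution (\<lambda>z. ennreal (norm (\<Theta> z) * norm z powr (\<alpha> - DIM(real^'n)))) (\<lambda>y. norm (g y)) x"
  unfolding nn_convolution_def
proof (rule nn_integral_cong)
  fix y
  \<comment> \<open>True also for \<open>x = y\<close>, where both sides are 0.\<close>
  have "norm (x - y) powr (\<alpha> - DIM(real^'n)) = 1 / norm (x - y) powr (real CARD('n) - \<alpha>)"
    by (simp add: powr_minus_divide[symmetric])
  then show "ennreal (norm (frac_integrand \<Theta> \<alpha> g x y))
    = ennreal (norm (\<Theta> (x - y)) * norm (x - y) powr (\<alpha> - DIM(real^'n))) * ennreal (norm (g y))"
    by (simp add: frac_integrand_def norm_mult norm_divide ennreal_mult[symmetric])
qed

text \<open>From \<open>s' \<le> p\<close> follows \<open>1 / p \<le> 1 / s' = 1 - 1 / s\<close>,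
  which rearranges to \<open>p' \<le> s\<close>: the integrability of \<open>\<Omega>\<close> covers
  the dual exponent. Finite \<open>s\<close> keeps \<open>1 - 1 / s\<close> below 1, which forces
  \<open>p > 1\<close>.\<close>

lemma conjugate_exponent_le:
  fixes s s' :: ennreal and p :: real
  assumes s: "1 < s" "s < top" and conj: "1 / s + 1 / s' = 1" and le: "s' \<le> ennreal p"
  shows "p > 1" "p / (p - 1) \<le> enn2real s"
proof -
  obtain r where r: "s = ennreal r" "r > 1"
    using s by (cases s) (auto simp: ennreal_less_iff simp flip: ennreal_1)
  obtain t where t: "s' = ennreal t" "t \<ge> 0"
    using le by (cases s') (auto simp: top_unique)
  \<comment> \<open>In \<open>ennreal\<close> the quotient \<open>1 / 0\<close> is
    \<open>top\<close>, so \<open>s' = 0\<close> would make the sum of reciprocals infinite.\<close>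
  have "t \<noteq> 0"
    using conj t by auto
  then have t0: "t > 0" using t by simp
  have "ennreal (1 / r + 1 / t) = ennreal 1"
    using conj r t t0 by (simp add: divide_ennreal[symmetric] ennreal_plus ennreal_1[symmetric] del: ennreal_1)
  then have rt: "1 / r + 1 / t = 1"
    using r t0 by (subst (asm) ennreal_inj) auto
  have "t \<le> p" using le t0 t(1) by (cases "p \<ge> 0") (auto simp: ennreal_le_iff ennreal_neg)
  then have "1 / p \<le> 1 / t" using t0 by (intro divide_left_mono) auto
  then have *: "1 / p \<le> 1 - 1 / r" using rt by simp
  also have "\<dots> < 1" using r by simp
  finally show p: "p > 1" using t0 \<open>t \<le> p\<close> by (simp add: field_simps)
  then show "p / (p - 1) \<le> enn2real s" using * r by (simp add: field_simps)
qed

text \<open>The ball has finite measure and \<open>t powr e \<le> 1 + t powr r\<close> whenever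
  \<open>0 \<le> e \<le> r\<close>, so exponents below \<open>s\<close> are covered. It is applied
  with exponent 1 for the near part and with \<open>p'\<close> for the far part.\<close>

lemma nn_integral_ball_powr_less_top:
  fixes \<Theta> :: "'a::euclidean_space \<Rightarrow> complex" and e :: real
  assumes [measurable]: "\<Theta> \<in> borel_measurable borel"
    and bd: "s = top \<Longrightarrow> \<exists>M. \<forall>x. norm (\<Theta> x) \<le> M"
    and fin: "s < top \<Longrightarrow> (\<integral>\<^sup>+x. ennreal (norm (\<Theta> x) powr enn2real s) * indicator (ball 0 1) x \<partial>lborel) < top"
    and e: "e \<ge> 0" "s < top \<Longrightarrow> e \<le> enn2real s"
  shows "(\<integral>\<^sup>+x. ennreal (norm (\<Theta> x) powr e) * indicator (ball 0 1) x \<partial>lborel) < top"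
proof (cases "s = top")
  case True
  then obtain M where M: "\<And>x. norm (\<Theta> x) \<le> M" using bd by blast
  have "(\<integral>\<^sup>+x. ennreal (norm (\<Theta> x) powr e) * indicator (ball 0 1) x \<partial>lborel)
      \<le> (\<integral>\<^sup>+x. ennreal (M powr e) * indicator (ball (0::'a) 1) x \<partial>lborel)"
    using e M by (intro nn_integral_mono mult_right_mono ennreal_leI powr_mono2) auto
  also have "\<dots> < top"
    using emeasure_lborel_ball_finite[of "0::'a" 1]
    by (simp add: nn_integral_cmult_indicator ennreal_mult_less_top)
  finally show ?thesis .
next
  case False
  then have s: "s < top" by (simp add: less_top)
  define r where "r = enn2real s"
  have "(\<integral>\<^sup>+x. ennreal (norm (\<Theta> x) powr e) * indicator (ball 0 1) x \<partial>lborel)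
      \<le> (\<integral>\<^sup>+x. indicator (ball 0 1) x + ennreal (norm (\<Theta> x) powr r) * indicator (ball 0 1) x \<partial>lborel)"
  proof (rule nn_integral_mono)
    fix x :: 'a
    have "norm (\<Theta> x) powr e \<le> 1 + norm (\<Theta> x) powr r"
    proof (cases "norm (\<Theta> x) \<le> 1")
      case True
      then have "norm (\<Theta> x) powr e \<le> 1 powr e" using e by (intro powr_mono2) auto
      then show ?thesis using powr_ge_zero[of "norm (\<Theta> x)" r] unfolding powr_one_eq_one by linarith
    next
      case False
      then have "norm (\<Theta> x) powr e \<le> norm (\<Theta> x) powr r"
        using e s by (intro powr_mono) (auto simp: r_def)
      then show ?thesis by simp
    qed
    then have "ennreal (norm (\<Theta> x) powr e) \<le> 1 + ennreal (norm (\<Theta> x) powr r)"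
      by (simp add: ennreal_1[symmetric] ennreal_plus[symmetric] ennreal_leI del: ennreal_1 ennreal_plus)
    then show "ennreal (norm (\<Theta> x) powr e) * indicator (ball 0 1) x
       \<le> indicator (ball 0 1) x + ennreal (norm (\<Theta> x) powr r) * indicator (ball 0 1) x"
      by (auto simp: indicator_def)
  qed
  also have "\<dots> = emeasure lborel (ball (0::'a) 1) +
      (\<integral>\<^sup>+x. ennreal (norm (\<Theta> x) powr r) * indicator (ball 0 1) x \<partial>lborel)"
  proof -
    have "(\<lambda>x. indicator (ball 0 1) x :: ennreal) \<in> borel_measurable (lborel :: 'a measure)"
      by (intro borel_measurable_indicator) simp
    then show ?thesis by (simp add: nn_integral_add)
  qed
  also have "\<dots> < top"
    using fin[OF s] emeasure_lborel_ball_finite[of "0::'a" 1] by (simp add: r_def)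
  finally show ?thesis .
qed

section \<open>Almost everywhere convergence and bounds for the rough operator\<close>

lemma frac_integral_bounds:
  fixes \<Omega> :: "real^'n \<Rightarrow> complex" and s s' :: ennreal and \<alpha> p q :: real
  assumes s: "1 < s" and hom: "homogeneous_degree_zero \<Omega>"
    and L: "\<Omega> \<in> Lp_space sphere_measure s"
    and conj: "1 / s + 1 / s' = 1" and s': "s' \<le> ennreal p"
    and \<alpha>: "0 < \<alpha>" and p: "1 \<le> p" and "p < q"
    and pq: "1 / q = 1 / p - \<alpha> / real CARD('n)"
  obtains C where "C > 0"
    "\<And>f. f \<in> Lp_space lebesgue (ennreal p) \<Longrightarrow> frac_integral_well_defined \<Omega> \<alpha> f"
    "\<And>f. f \<in> Lp_space lebesgue (ennreal p) \<Longrightarrow>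
       weak_Lp_norm lebesgue q (frac_integral \<Omega> \<alpha> f) \<le> ennreal C * Lp_norm lebesgue (ennreal p) f"
    "\<And>f. f \<in> Lp_space lebesgue (ennreal p) \<Longrightarrow> p > 1 \<Longrightarrow>
       Lp_norm lebesgue (ennreal q) (frac_integral \<Omega> \<alpha> f) \<le> ennreal C * Lp_norm lebesgue (ennreal p) f"
proof -
  have q: "q > 0" using p \<open>p < q\<close> by simp
  have s0: "s > 0" using s by (rule less_trans[rotated]) simp
  obtain \<Theta> :: "real^'n \<Rightarrow> complex" where \<Theta> [measurable]: "\<Theta> \<in> borel_measurable borel"
    and \<Theta>hom: "\<forall>t>0. \<forall>x. \<Theta> (t *\<^sub>R x) = \<Theta> x" and \<Theta>ae: "AE x in lborel. \<Omega> x = \<Theta> x"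
    and bd: "s = top \<Longrightarrow> \<exists>M. \<forall>x. norm (\<Theta> x) \<le> M"
    and fin: "s < top \<Longrightarrow> (\<integral>\<^sup>+x. ennreal (norm (\<Theta> x) powr enn2real s) * indicator (ball 0 1) x \<partial>lborel) < top"
    using homogeneous_borel_representative[OF hom L s0] by blast
  note ball = nn_integral_ball_powr_less_top[OF \<Theta> bd fin]
  have W: "(\<lambda>x. norm (\<Theta> x)) \<in> borel_measurable borel" by measurable
  have Whom: "\<forall>t>0. \<forall>x. norm (\<Theta> (t *\<^sub>R x)) = norm (\<Theta> x)" using \<Theta>hom by simp
  have "1 \<le> enn2real s" if "s < top"
    using s that by (cases s) (auto simp: ennreal_less_iff simp flip: ennreal_1)
  then have int1: "(\<integral>\<^sup>+x. ennreal (norm (\<Theta> x)) * indicator (ball 0 1) x \<partial>lborel) < top"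
    using ball[of 1] by simp
  have int: "p = 1 \<and> (\<exists>M. \<forall>x. norm (\<Theta> x) \<le> M) \<or>
     p > 1 \<and> (\<integral>\<^sup>+x. ennreal (norm (\<Theta> x) powr (p / (p - 1))) * indicator (ball 0 1) x \<partial>lborel) < top"
  proof (cases "p = 1")
    case True
    \<comment> \<open>At \<open>p = 1\<close> the conjugacy leaves only \<open>s = top\<close>,
      where the representative is bounded.\<close>
    then have "\<not> s < top" using conjugate_exponent_le(1)[OF s _ conj s'] by auto
    then show ?thesis using True bd less_top[of s] by blast
  next
    case False
    then have "p > 1" using p by simp
    then show ?thesis using conjugate_exponent_le(2)[OF s _ conj s'] by (auto intro!: ball)
  qed
  have pq': "1 / q = 1 / p - \<alpha> / DIM(real^'n)" using pq by simp
  define K where "K z = ennreal (norm (\<Theta> z) * norm z powr (\<alpha> - DIM(real^'n)))" for z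
  have K [measurable]: "K \<in> borel_measurable borel" unfolding K_def[abs_def] by measurable
  obtain C where C: "C > 0" and bounds:
    "\<forall>u F v. u \<in> borel_measurable borel \<and> (\<forall>x. u x \<ge> 0) \<and> F > 0 \<and>
       (\<integral>\<^sup>+x. ennreal (u x powr p) \<partial>lborel) \<le> ennreal (F powr p) \<longrightarrow>
       (\<forall>l>0. emeasure lborel {x. ennreal l < nn_convolution K u x} \<le> ennreal ((C * F / l) powr q)) \<and>
       (p > 1 \<and> v \<in> borel_measurable borel \<and> (\<forall>x. v x \<ge> 0 \<and> ennreal (v x) \<le> nn_convolution K u x) \<longrightarrow>
          (\<integral>\<^sup>+x. ennreal (v x powr q) \<partial>lborel) \<le> ennreal ((C * F) powr q))"
    using nn_convolution_bounds[OF W Whom norm_ge_zero int1 int \<alpha> p q pq'] unfolding K_def[abs_def] by blast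
  have main: "frac_integral_well_defined \<Omega> \<alpha> f \<and>
      weak_Lp_norm lebesgue q (frac_integral \<Omega> \<alpha> f) \<le> ennreal C * Lp_norm lebesgue (ennreal p) f \<and>
      (p > 1 \<longrightarrow> Lp_norm lebesgue (ennreal q) (frac_integral \<Omega> \<alpha> f) \<le> ennreal C * Lp_norm lebesgue (ennreal p) f)"
    if f: "f \<in> Lp_space lebesgue (ennreal p)" for f
  proof -
    obtain b where b: "b \<ge> 0" "Lp_norm lebesgue (ennreal p) f = ennreal b"
      "(\<integral>\<^sup>+x. ennreal (norm (f x) powr p) \<partial>lebesgue) = ennreal (b powr p)"
      using f p by (auto simp: Lp_space_def elim: nn_integral_powr_of_Lp_norm)
    obtain g where g [measurable]: "g \<in> borel_measurable lborel" and gae: "AE x in lborel. f x = g x"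
      using f by (auto simp: Lp_space_def elim: exists_borel_representative)
    have g' [measurable]: "g \<in> borel_measurable borel" using g by simp
    define u where "u x = norm (g x)" for x
    have u [measurable]: "u \<in> borel_measurable borel" unfolding u_def[abs_def] by measurable
    have u0: "\<forall>x. u x \<ge> 0" by (simp add: u_def)
    have ub: "(\<integral>\<^sup>+x. ennreal (u x powr p) \<partial>lborel) = ennreal (b powr p)"
      unfolding b(3)[symmetric] nn_integral_completion u_def
      by (rule nn_integral_cong_AE) (use gae in \<open>eventually_elim; simp\<close>)
    \<comment> \<open>The strict inequality ensures \<open>F > 0\<close> even when \<open>f\<close>
      vanishes almost everywhere.\<close>
    have uF: "(\<integral>\<^sup>+x. ennreal (u x powr p) \<partial>lborel) \<le> ennreal (F powr p)" if "F > b" for F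
      using that b(1) p unfolding ub by (intro ennreal_leI powr_mono2) auto
    define h where "h x = (\<integral>y. frac_integrand \<Theta> \<alpha> g x y \<partial>lborel)" for x
    have h [measurable]: "h \<in> borel_measurable borel"
      unfolding h_def[abs_def] frac_integrand_def[abs_def] by measurable
    have fh: "frac_integral \<Omega> \<alpha> f = h"
      using frac_integral_representative(2)[OF \<Theta> g' \<Theta>ae gae] by (auto simp: h_def)
    have norm_int: "(\<integral>\<^sup>+y. ennreal (norm (frac_integrand \<Theta> \<alpha> g x y)) \<partial>lborel) = nn_convolution K u x" for x
      by (simp only: nn_integral_norm_frac_integrand K_def[abs_def] u_def[abs_def])
    have hle: "ennreal (norm (h x)) \<le> nn_convolution K u x" for x
    proof (cases "integrable lborel (frac_integrand \<Theta> \<alpha> g x)")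
      case True
      then show ?thesis
        unfolding h_def norm_int[symmetric] by (rule integral_norm_bound_ennreal)
    next
      \<comment> \<open>At points of divergence the integral has the default value 0, so the bound
        is trivial.\<close>
      case False
      then show ?thesis by (simp add: h_def not_integrable_integral_eq)
    qed
    have weak: "emeasure lborel {x. ennreal l < nn_convolution K u x} \<le> ennreal ((C * F / l) powr q)"
      if "F > b" "l > 0" for F l
      using bounds u u0 uF[OF that(1)] that b(1) by (meson le_less_trans)
    have strong: "(\<integral>\<^sup>+x. ennreal (norm (h x) powr q) \<partial>lborel) \<le> ennreal ((C * F) powr q)"
      if "F > b" "p > 1" for F
    proof -
      have "F > 0" using that b(1) by simp
      moreover have "(\<lambda>x. norm (h x)) \<in> borel_measurable borel" by measurable
      ultimately show ?thesis
        using bounds[rule_format, of u F "\<lambda>x. norm (h x)"] u u0 uF[OF that(1)] that hle by simp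
    qed
    have null: "emeasure lborel {x. nn_convolution K u x = top} = 0"
    proof -
      have "emeasure lborel {x. nn_convolution K u x = top} \<le> 0"
      proof (rule ennreal_le_epsilon)
        fix e :: real assume e: "e > 0"
        \<comment> \<open>Infinite values exceed every level; this level solves
          \<open>(C * F / l) powr q = e\<close> for the admissible choice
          \<open>F = b + 1\<close>.\<close>
        define l where "l = C * (b + 1) / e powr (1 / q)"
        have l: "l > 0" using C b(1) e by (simp add: l_def)
        have "emeasure lborel {x. nn_convolution K u x = top} \<le> emeasure lborel {x. ennreal l < nn_convolution K u x}"
          by (rule emeasure_mono) auto
        also have "\<dots> \<le> ennreal ((C * (b + 1) / l) powr q)"
          using l by (intro weak) auto
        also have "(C * (b + 1) / l) powr q = e"
          using C b(1) e q by (simp add: l_def powr_powr)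
        finally show "emeasure lborel {x. nn_convolution K u x = top} \<le> 0 + ennreal e" by simp
      qed
      then show ?thesis by simp
    qed
    \<comment> \<open>A finite convolution of moduli is absolute convergence of the defining
      integral.\<close>
    have "AE x in lborel. nn_convolution K u x \<noteq> top"
      by (rule AE_I[OF _ null]) auto
    then have "AE x in lborel. integrable lebesgue (frac_integrand \<Omega> \<alpha> f x)"
    proof eventually_elim
      case (elim x)
      have "frac_integrand \<Theta> \<alpha> g x \<in> borel_measurable lborel"
        unfolding frac_integrand_def[abs_def] by measurable
      then have "integrable lborel (frac_integrand \<Theta> \<alpha> g x)"
        using elim by (simp add: integrable_iff_bounded norm_int less_top)
      then show ?case
        using frac_integral_representative(1)[OF \<Theta> g' \<Theta>ae gae] by blast
    qed
    then have "AE x in lebesgue. integrable lebesgue (frac_integrand \<Omega> \<alpha> f x)"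
      by (rule AE_completion)
    moreover have "h \<in> borel_measurable lebesgue"
      using h by (simp add: measurable_completion)
    ultimately have "frac_integral_well_defined \<Omega> \<alpha> f"
      by (simp add: frac_integral_well_defined_def fh)
    moreover have "weak_Lp_norm lebesgue q (frac_integral \<Omega> \<alpha> f) \<le> ennreal (C * b)"
    proof (rule ennreal_le_cmult_of_gt[OF _ C b(1)])
      fix F assume F: "F > b"
      show "weak_Lp_norm lebesgue q (frac_integral \<Omega> \<alpha> f) \<le> ennreal (C * F)"
        unfolding weak_Lp_norm_def fh
      proof (rule SUP_least)
        fix t :: real assume "t \<in> {0<..}"
        then have t: "t > 0" by simp
        have "emeasure lebesgue {x \<in> space lebesgue. norm (h x) > t} = emeasure lborel {x. t < norm (h x)}"
          by simp
        also have "\<dots> \<le> emeasure lborel {x. ennreal t < nn_convolution K u x}"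
        proof (intro emeasure_mono subsetI)
          fix x assume "x \<in> {x. t < norm (h x)}"
          then have "ennreal t < ennreal (norm (h x))" using t by (intro ennreal_lessI) auto
          then show "x \<in> {x. ennreal t < nn_convolution K u x}" using hle[of x] by auto
        qed simp
        also have "\<dots> \<le> ennreal ((C * F / t) powr q)" by (rule weak[OF F t])
        finally have "enn_powr (emeasure lebesgue {x \<in> space lebesgue. norm (h x) > t}) (1 / q) \<le> ennreal (C * F / t)"
          by (rule enn_powr_le) (use q C F b t in auto)
        then have "ennreal t * enn_powr (emeasure lebesgue {x \<in> space lebesgue. norm (h x) > t}) (1 / q)
            \<le> ennreal t * ennreal (C * F / t)"
          by (intro mult_left_mono) auto
        also have "\<dots> = ennreal (C * F)"
          using t C F b(1) by (simp add: ennreal_mult[symmetric])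
        finally show "ennreal t * enn_powr (emeasure lebesgue {x \<in> space lebesgue. norm (h x) > t}) (1 / q)
            \<le> ennreal (C * F)" .
      qed
    qed
    moreover have "Lp_norm lebesgue (ennreal q) (frac_integral \<Omega> \<alpha> f) \<le> ennreal (C * b)" if "p > 1"
    proof (rule ennreal_le_cmult_of_gt[OF _ C b(1)])
      fix F assume F: "F > b"
      show "Lp_norm lebesgue (ennreal q) (frac_integral \<Omega> \<alpha> f) \<le> ennreal (C * F)"
        unfolding Lp_norm_ennreal[OF q] fh nn_integral_completion
        by (rule enn_powr_le[OF strong[OF F that] q]) (use C F b(1) in simp)
    qed
    ultimately show ?thesis
      using C b by (simp add: ennreal_mult)
  qed
  show ?thesis by (rule that[OF C]) (use main in blast)+
qed

theorem theorem2p1: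
  fixes \<Omega> :: "real^'n \<Rightarrow> complex" and s s' :: ennreal and \<alpha> p q :: real
  assumes "CARD('n) \<ge> 2"
    and "1 < s"
    and "homogeneous_degree_zero \<Omega>"
    and "\<Omega> \<in> Lp_space sphere_measure s"
    and "1 / s + 1 / s' = 1"
    and "0 < \<alpha>" and "\<alpha> < real CARD('n)"
    and "1 \<le> p" and "p < q"
    and "1 / q = 1 / p - \<alpha> / real CARD('n)"
  shows "(s' = ennreal p \<and> p < real CARD('n) / \<alpha> \<longrightarrow>
           (\<exists>C>0. \<forall>f\<in>Lp_space lebesgue (ennreal p).
              frac_integral_well_defined \<Omega> \<alpha> f \<and>
              weak_Lp_norm lebesgue q (frac_integral \<Omega> \<alpha> f)
                \<le> ennreal C * Lp_norm lebesgue (ennreal p) f))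
       \<and> (s' < ennreal p \<and> p < real CARD('n) / \<alpha> \<longrightarrow>
           (\<exists>C>0. \<forall>f\<in>Lp_space lebesgue (ennreal p).
              frac_integral_well_defined \<Omega> \<alpha> f \<and>
              Lp_norm lebesgue (ennreal q) (frac_integral \<Omega> \<alpha> f)
                \<le> ennreal C * Lp_norm lebesgue (ennreal p) f))"
proof (intro conjI impI; elim conjE)
  assume "s' = ennreal p"
  then have "s' \<le> ennreal p" by simp
  from frac_integral_bounds[OF assms(2-5) this assms(6,8-10)]
  show "\<exists>C>0. \<forall>f\<in>Lp_space lebesgue (ennreal p). frac_integral_well_defined \<Omega> \<alpha> f \<and>
          weak_Lp_norm lebesgue q (frac_integral \<Omega> \<alpha> f) \<le> ennreal C * Lp_norm lebesgue (ennreal p) f"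
    by metis
next
  assume s': "s' < ennreal p"
  \<comment> \<open>The strong bound is available for \<open>p > 1\<close>. Finite \<open>s\<close>
    yields this directly, while \<open>s = top\<close> gives \<open>s' = 1\<close>, and there it
    comes from the strictness of \<open>s' < p\<close>.\<close>
  have "p > 1"
  proof (cases "s < top")
    case True
    then show ?thesis using conjugate_exponent_le(1)[OF assms(2) _ assms(5)] s' by simp
  next
    case False
    then have "1 / s' = 1" using assms(5) by (simp add: less_top[symmetric])
    then have "s' = 1"
    proof (cases s')
      case (real r)
      with \<open>1 / s' = 1\<close> have "r > 0" by (cases "r = 0") auto
      then have "ennreal (1 / r) = ennreal 1"
        using real \<open>1 / s' = 1\<close> by (simp add: divide_ennreal[symmetric])
      then show ?thesis using real \<open>r > 0\<close> by simp
    qed simp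
    then show ?thesis using s' by (simp add: ennreal_less_iff flip: ennreal_1)
  qed
  with frac_integral_bounds[OF assms(2-5) less_imp_le[OF s'] assms(6,8-10)]
  show "\<exists>C>0. \<forall>f\<in>Lp_space lebesgue (ennreal p). frac_integral_well_defined \<Omega> \<alpha> f \<and>
          Lp_norm lebesgue (ennreal q) (frac_integral \<Omega> \<alpha> f) \<le> ennreal C * Lp_norm lebesgue (ennreal p) f"
    by metis
qed

end
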